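(* Let $\Gamma$ be a finite connected graph, $\rho$ a (flat unitary complex) line bundle on $\Gamma$ with $H_0(\Gamma;\rho)=0$, and $r\colon \Gamma_1\to\mathbb{R}_{+}$ a resistance function. Then $$\det\bigl(\partial\partial_R^*\colon C_0(\Gamma;\rho)\to C_0(\Gamma;\rho)\bigr)=\sum_T w_T ,$$ where $T$ ranges over all $\rho$-spanning trees of $\Gamma$.
   Context: Graphs. A graph $\Gamma$ is a one-dimensional CW complex with vertex set $\Gamma_0$ and edge set $\Gamma_1$; it is given by a map $(d_0,d_1)\colon\Gamma_1\to\Gamma_0\times\Gamma_0$ sending an (oriented) edge to its initial and terminal endpoints. Loop edges ($d_0(b)=d_1(b)$) and multiple edges are allowed. For a subcomplex $A\subset\Gamma$, $A_0,A_1$ denote its vertices and edges. A circuit is a simple closed path (a loop edge, or two parallel edges, may form a circuit). Line bundle and holonomy. After choosing unit vectors in the fibers, a (flat unitary complex) line bundle $\rho$ on $\Gamma$ is a function $\Gamma_1\to U(1)$, $b\mapsto\rho_b$. For an oriented circuit $C$, the holonomy is $\rho_C=\prod_{b\in C_1}\rho_b^{s_b}$, where $s_b=1$ if the orientation of $b$ agrees with that of $C$ and $s_b=-1$ otherwise. Write $z^*$ for the complex conjugate of $z\in\mathbb{C}$. If $A\subset\Gamma$ is a subgraph each of whose connected components $A_\alpha$ has Euler characteristic zero, then each $A_\alpha$ has a unique circuit $C_\alpha$; orienting these arbitrarily, set $\hat\rho_A=\prod_\alpha(\rho_{C_\alpha}-1)(\rho_{C_\alpha}^*-1)$, a real number independent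 of the orientations. Twisted chains. $C_i(\Gamma;\rho)$ ($i=0,1$) is the complex vector space with basis $\Gamma_i$, and $\partial\colon C_1(\Gamma;\rho)\to C_0(\Gamma;\rho)$ is the linear map with $\partial b=\rho_b\,d_0(b)-d_1(b)$. $H_*(\Gamma;\rho)$ is the homology of this complex, so $H_1(\Gamma;\rho)=\ker\partial$ and $H_0(\Gamma;\rho)=\operatorname{coker}\partial$. The same definitions apply to subcomplexes of $\Gamma$, with $\rho$ restricted. Inner products and adjoint. The standard Hermitian inner product on $C_0(\Gamma;\rho)$ is the one making $\Gamma_0$ an orthonormal basis. For a resistance function $r$, $b\mapsto r_b>0$, the modified inner product on $C_1(\Gamma;\rho)$ is the Hermitian inner product given on edges by $\langle b,b'\rangle_R=r_b\delta_{bb'}$. $\partial_R^*\colon C_0(\Gamma;\rho)\to C_1(\Gamma;\rho)$ is the adjoint of $\partial$ with respect to the standard inner product on $C_0(\Gamma;\rho)$ and the modified inner product on $C_1(\Gamma;\rho)$. $\rho$-spanning trees. A $\rho$-spanning tree is a subcomplex $T\subset\Gamma$ with $T_0=\Gamma_0$, $H_1(T;\rho)=0$, and such that the inclusion induces an isomorphism $H_0(T;\rho)\to H_0(\Gamma;\rho)$. (Under the assumption $H_0(\Gamma;\rho)=0$, every component of a $\rho$-spanning tree has Euler characteristic zero, so $\hat\rho_T$ is defined.) The weight of $T$ is $w_T=\hat\rho_T\prod_{b\in T_1}r_b^{-1}$. *)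

theory Defs
  imports "HOL-Analysis.Analysis" "Graph_Theory.Digraph_Component"
begin

text \<open>
  Graphs with loops and multiple edges are represented by \<open>pre_digraph\<close>: the boundary map
  \<open>b \<mapsto> (d\<^sub>0(b), d\<^sub>1(b))\<close> is \<open>b \<mapsto> (tail G b, head G b)\<close>. The direction of an arc is only its
  reference orientation. Subcomplexes are subgraphs in the sense of \<open>subgraph\<close>, so
  \<open>tail\<close> and \<open>head\<close> of a subcomplex agree with those of the ambient graph. The library's
  \<open>connected\<close> disregards the directions and excludes the empty graph; it is written
  \<open>Digraph_Component.connected\<close> to keep it apart from topological connectedness.
\<close>

section \<open>Twisted chains and homology\<close>

text \<open>
  The chains of a subcomplex are the vectors supported on its cells, so that the inclusion of a
  subcomplex induces the identity on vectors.
\<close>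

definition C0 :: "('v::finite, 'e) pre_digraph \<Rightarrow> (complex^'v) set" where
  "C0 A = {x. \<forall>v. v \<notin> verts A \<longrightarrow> x $ v = 0}"

definition C1 :: "('v, 'e::finite) pre_digraph \<Rightarrow> (complex^'e) set" where
  "C1 A = {c. \<forall>b. b \<notin> arcs A \<longrightarrow> c $ b = 0}"

definition boundary ::
  "('v::finite, 'e::finite) pre_digraph \<Rightarrow> ('e \<Rightarrow> complex) \<Rightarrow> complex^'e \<Rightarrow> complex^'v" where
  "boundary A \<rho> c = (\<Sum>b\<in>arcs A. c $ b *s (\<rho> b *s axis (tail A b) 1 - axis (head A b) 1))"

definition H1 :: "('v::finite, 'e::finite) pre_digraph \<Rightarrow> ('e \<Rightarrow> complex) \<Rightarrow> (complex^'e) set" where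
  "H1 A \<rho> = {c \<in> C1 A. boundary A \<rho> c = 0}"

definition homologous ::
  "('v::finite, 'e::finite) pre_digraph \<Rightarrow> ('e \<Rightarrow> complex) \<Rightarrow> ((complex^'v) \<times> (complex^'v)) set" where
  "homologous A \<rho> = {(x, y). x \<in> C0 A \<and> y \<in> C0 A \<and> x - y \<in> boundary A \<rho> ` C1 A}"

text \<open>\<open>H0\<close> is the set of cosets of the image of the boundary map in \<open>C0\<close>.\<close>

definition H0 ::
  "('v::finite, 'e::finite) pre_digraph \<Rightarrow> ('e \<Rightarrow> complex) \<Rightarrow> (complex^'v) set set" where
  "H0 A \<rho> = C0 A // homologous A \<rho>"

text \<open>
  The map induced by an inclusion \<open>A \<subseteq> G\<close> sends the class of \<open>x\<close> in \<open>H0 A \<rho>\<close> to its class in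
  \<open>H0 G \<rho>\<close>, see \<open>H0_map_class\<close> below. It is automatically linear, so it is an isomorphism iff it
  is bijective.
\<close>

definition H0_map ::
  "('v::finite, 'e::finite) pre_digraph \<Rightarrow> ('e \<Rightarrow> complex) \<Rightarrow> (complex^'v) set \<Rightarrow> (complex^'v) set"
  where "H0_map G \<rho> X = homologous G \<rho> `` X"

section \<open>Inner products and the adjoint\<close>

definition inner0 ::
  "('v::finite, 'e) pre_digraph \<Rightarrow> complex^'v \<Rightarrow> complex^'v \<Rightarrow> complex" where
  "inner0 G x y = (\<Sum>v\<in>verts G. x $ v * cnj (y $ v))"

definition inner1 ::
  "('v, 'e::finite) pre_digraph \<Rightarrow> ('e \<Rightarrow> real) \<Rightarrow> complex^'e \<Rightarrow> complex^'e \<Rightarrow> complex" where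
  "inner1 G r c d = (\<Sum>b\<in>arcs G. of_real (r b) * c $ b * cnj (d $ b))"

definition boundary_adj ::
  "('v::finite, 'e::finite) pre_digraph \<Rightarrow> ('e \<Rightarrow> complex) \<Rightarrow> ('e \<Rightarrow> real) \<Rightarrow>
   complex^'v \<Rightarrow> complex^'e" where
  "boundary_adj G \<rho> r y =
     (THE d. d \<in> C1 G \<and> (\<forall>c\<in>C1 G. inner0 G (boundary G \<rho> c) y = inner1 G r c d))"

section \<open>Circuits and holonomy\<close>

text \<open>
  An oriented edge is a pair \<open>(b, s)\<close>, where \<open>s\<close> tells whether \<open>b\<close> is traversed along its
  reference orientation.
\<close>

fun edge_src :: "('v, 'e) pre_digraph \<Rightarrow> 'e \<times> bool \<Rightarrow> 'v" where
  "edge_src A (b, s) = (if s then tail A b else head A b)"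

fun edge_tgt :: "('v, 'e) pre_digraph \<Rightarrow> 'e \<times> bool \<Rightarrow> 'v" where
  "edge_tgt A (b, s) = (if s then head A b else tail A b)"

text \<open>
  Distinctness of the underlying edges excludes traversing an edge back and forth; loops and pairs
  of parallel edges do give circuits.
\<close>

definition circuit :: "('v, 'e) pre_digraph \<Rightarrow> ('e \<times> bool) list \<Rightarrow> bool" where
  "circuit A C \<longleftrightarrow> C \<noteq> [] \<and> fst ` set C \<subseteq> arcs A \<and>
     (\<forall>i < length C. edge_tgt A (C ! i) = edge_src A (C ! (Suc i mod length C))) \<and>
     distinct (map (edge_src A) C) \<and> distinct (map fst C)"

definition holonomy :: "('e \<Rightarrow> complex) \<Rightarrow> ('e \<times> bool) list \<Rightarrow> complex" where
  "holonomy \<rho> C = (\<Prod>(b, s)\<leftarrow>C. if s then \<rho> b else inverse (\<rho> b))"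

definition components :: "('v, 'e) pre_digraph \<Rightarrow> ('v, 'e) pre_digraph set" where
  "components A = {H. pre_digraph.max_subgraph A Digraph_Component.connected H}"

text \<open>
  Meaningful only if every component of \<open>A\<close> has Euler characteristic zero. Then the circuit of a
  component is unique up to its starting point and orientation, and neither choice affects the
  factor.
\<close>

definition rho_hat :: "('v, 'e) pre_digraph \<Rightarrow> ('e \<Rightarrow> complex) \<Rightarrow> complex" where
  "rho_hat A \<rho> =
     (\<Prod>H\<in>components A. let h = holonomy \<rho> (SOME C. circuit H C) in (h - 1) * (cnj h - 1))"

section \<open>Twisted spanning trees\<close>

definition rho_spanning_tree ::
  "('v::finite, 'e::finite) pre_digraph \<Rightarrow> ('e \<Rightarrow> complex) \<Rightarrow> ('v, 'e) pre_digraph \<Rightarrow> bool" where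
  "rho_spanning_tree G \<rho> T \<longleftrightarrow> subgraph T G \<and> verts T = verts G \<and> H1 T \<rho> = {0} \<and>
     bij_betw (H0_map G \<rho>) (H0 T \<rho>) (H0 G \<rho>)"

definition tree_weight ::
  "('v, 'e) pre_digraph \<Rightarrow> ('e \<Rightarrow> complex) \<Rightarrow> ('e \<Rightarrow> real) \<Rightarrow> complex" where
  "tree_weight T \<rho> r = rho_hat T \<rho> * (\<Prod>b\<in>arcs T. of_real (inverse (r b)))"

section \<open>Well-definedness\<close>

lemma boundary_add: "boundary A \<rho> (c + d) = boundary A \<rho> c + boundary A \<rho> d"
  by (simp add: boundary_def vec_eq_iff algebra_simps flip: sum.distrib)

lemma boundary_scale: "boundary A \<rho> (k *s c) = k *s boundary A \<rho> c"
  by (simp add: boundary_def vec_eq_iff sum_distrib_left algebra_simps)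

lemma boundary_subgraph:
  assumes "subgraph A G" "c \<in> C1 A"
  shows "boundary G \<rho> c = boundary A \<rho> c"
proof -
  from assms have *: "arcs A \<subseteq> arcs G" "tail A = tail G" "head A = head G"
    by (auto simp: subgraph_def compatible_def)
  show ?thesis
    unfolding boundary_def * using assms(2) *(1)
    by (intro sum.mono_neutral_right) (auto simp: C1_def)
qed

lemma equiv_homologous: "equiv (C0 A) (homologous A \<rho>)"
proof (rule equivI)
  have minus: "boundary A \<rho> (- c) = - boundary A \<rho> c" for c
    using boundary_scale[of A \<rho> "-1" c] by (simp add: vec_eq_iff)
  show "homologous A \<rho> \<subseteq> C0 A \<times> C0 A"
    by (auto simp: homologous_def)
  have "0 \<in> boundary A \<rho> ` C1 A"
    by (rule image_eqI[of _ _ 0]) (auto simp: boundary_def C1_def)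
  then show "refl_on (C0 A) (homologous A \<rho>)"
    by (auto simp: refl_on_def homologous_def)
  show "sym (homologous A \<rho>)"
  proof (rule symI)
    fix x y assume xy: "(x, y) \<in> homologous A \<rho>"
    then obtain c where c: "c \<in> C1 A" "x - y = boundary A \<rho> c" by (auto simp: homologous_def)
    then have "y - x = boundary A \<rho> (- c)" "- c \<in> C1 A"
      by (simp_all add: minus C1_def flip: c(2))
    with xy show "(y, x) \<in> homologous A \<rho>" by (auto simp: homologous_def)
  qed
  show "trans (homologous A \<rho>)"
  proof (rule transI)
    fix x y z assume xyz: "(x, y) \<in> homologous A \<rho>" "(y, z) \<in> homologous A \<rho>"
    then obtain c d where "c \<in> C1 A" "x - y = boundary A \<rho> c" "d \<in> C1 A" "y - z = boundary A \<rho> d"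
      by (auto simp: homologous_def)
    then have "x - z = boundary A \<rho> (c + d)" "c + d \<in> C1 A"
      by (simp_all add: boundary_add C1_def algebra_simps)
    with xyz show "(x, z) \<in> homologous A \<rho>" by (auto simp: homologous_def)
  qed
qed

lemma homologous_subgraph:
  assumes "subgraph A G"
  shows "homologous A \<rho> \<subseteq> homologous G \<rho>"
proof -
  have "C0 A \<subseteq> C0 G" "C1 A \<subseteq> C1 G"
    using assms by (auto simp: subgraph_def C0_def C1_def)
  moreover have "boundary A \<rho> ` C1 A \<subseteq> boundary G \<rho> ` C1 G"
  proof (rule image_subsetI)
    fix c assume "c \<in> C1 A"
    then show "boundary A \<rho> c \<in> boundary G \<rho> ` C1 G"
      using \<open>C1 A \<subseteq> C1 G\<close> boundary_subgraph[OF assms, of c \<rho>] by (intro image_eqI[of _ _ c]) auto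
  qed
  ultimately show ?thesis
    by (auto simp: homologous_def)
qed

lemma H0_map_class:
  assumes "subgraph A G" "x \<in> C0 A"
  shows "H0_map G \<rho> (homologous A \<rho> `` {x}) = homologous G \<rho> `` {x}"
proof -
  have "(x, x) \<in> homologous A \<rho>"
    using equiv_homologous[of A \<rho>] assms(2) by (simp add: equiv_def refl_on_def)
  moreover have "homologous G \<rho> `` {x} = homologous G \<rho> `` {y}" if "(x, y) \<in> homologous A \<rho>" for y
    using homologous_subgraph[OF assms(1)] that by (intro equiv_class_eq[OF equiv_homologous]) blast
  ultimately show ?thesis
    unfolding H0_map_def by blast
qed

lemma boundary_adj:
  fixes G :: "('v::finite, 'e::finite) pre_digraph"
  assumes "wf_digraph G" "\<And>b. b \<in> arcs G \<Longrightarrow> r b > 0"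
  shows boundary_adj_in_C1: "boundary_adj G \<rho> r y \<in> C1 G"
    and inner_boundary_adj:
      "\<And>c. c \<in> C1 G \<Longrightarrow> inner0 G (boundary G \<rho> c) y = inner1 G r c (boundary_adj G \<rho> r y)"
proof -
  define f :: "'e \<Rightarrow> complex" where
    "f b = \<rho> b * cnj (y $ tail G b) - cnj (y $ head G b)" for b
  define d0 :: "complex^'e" where
    "d0 = (\<chi> b. if b \<in> arcs G then cnj (f b) / of_real (r b) else 0)"
  have expand: "inner0 G (boundary G \<rho> c) y = (\<Sum>b\<in>arcs G. c $ b * f b)" for c
  proof -
    have delta: "(\<Sum>v\<in>verts G. axis w (1::complex) $ v * cnj (y $ v)) = cnj (y $ w)"
      if "w \<in> verts G" for w
      using that by (simp add: axis_def if_distrib[of "\<lambda>z. z * _"] cong: if_cong)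
    have "inner0 G (boundary G \<rho> c) y = (\<Sum>v\<in>verts G. \<Sum>b\<in>arcs G.
        c $ b * (\<rho> b * axis (tail G b) 1 $ v - axis (head G b) 1 $ v) * cnj (y $ v))"
      unfolding inner0_def boundary_def by (simp add: sum_distrib_right right_diff_distrib mult.assoc)
    also have "\<dots> = (\<Sum>b\<in>arcs G. \<Sum>v\<in>verts G.
        c $ b * (\<rho> b * axis (tail G b) 1 $ v - axis (head G b) 1 $ v) * cnj (y $ v))"
      by (rule sum.swap)
    also have "\<dots> = (\<Sum>b\<in>arcs G. c $ b *
        (\<rho> b * (\<Sum>v\<in>verts G. axis (tail G b) 1 $ v * cnj (y $ v)) -
         (\<Sum>v\<in>verts G. axis (head G b) 1 $ v * cnj (y $ v))))"
      by (simp add: sum_distrib_left sum_subtractf algebra_simps)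
    also have "\<dots> = (\<Sum>b\<in>arcs G. c $ b * f b)"
      using assms(1) by (intro sum.cong) (simp_all add: delta f_def wf_digraph_def)
    finally show ?thesis .
  qed
  have "\<exists>!d. d \<in> C1 G \<and> (\<forall>c\<in>C1 G. inner0 G (boundary G \<rho> c) y = inner1 G r c d)"
  proof (rule ex1I[of _ d0])
    show "d0 \<in> C1 G \<and> (\<forall>c\<in>C1 G. inner0 G (boundary G \<rho> c) y = inner1 G r c d0)"
    proof -
      have "inner1 G r c d0 = (\<Sum>b\<in>arcs G. c $ b * f b)" for c
        unfolding inner1_def using assms(2) by (intro sum.cong) (force simp: d0_def)+
      then show ?thesis
        by (simp add: expand C1_def d0_def)
    qed
  next
    fix d assume d: "d \<in> C1 G \<and> (\<forall>c\<in>C1 G. inner0 G (boundary G \<rho> c) y = inner1 G r c d)"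
    have "d $ b = d0 $ b" for b
    proof (cases "b \<in> arcs G")
      case True
      then have "axis b 1 \<in> C1 G" by (auto simp: C1_def axis_def)
      with d have "inner0 G (boundary G \<rho> (axis b 1)) y = inner1 G r (axis b 1) d" by blast
      then have "f b = of_real (r b) * cnj (d $ b)"
        using True unfolding expand inner1_def
        by (simp add: axis_def if_distrib[of "\<lambda>z. z * _"] if_distrib[of "\<lambda>z. _ * z"] cong: if_cong)
      then show ?thesis
        using assms(2)[OF True] True by (simp add: d0_def)
    qed (use d in \<open>auto simp: C1_def d0_def\<close>)
    then show "d = d0" by (simp add: vec_eq_iff)
  qed
  from theI'[OF this]
  show "boundary_adj G \<rho> r y \<in> C1 G"
    "\<And>c. c \<in> C1 G \<Longrightarrow> inner0 G (boundary G \<rho> c) y = inner1 G r c (boundary_adj G \<rho> r y)"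
    by (auto simp: boundary_adj_def)
qed

lemma finite_rho_spanning_trees:
  "finite {T. rho_spanning_tree (G :: ('v::finite, 'e::finite) pre_digraph) \<rho> T}"
proof (rule finite_subset)
  let ?mk = "\<lambda>(V, E). \<lparr>verts = V, arcs = E, tail = tail G, head = head G\<rparr>"
  show "{T. rho_spanning_tree G \<rho> T} \<subseteq> range ?mk"
  proof
    fix T assume "T \<in> {T. rho_spanning_tree G \<rho> T}"
    then have "T = ?mk (verts T, arcs T)"
      by (simp add: rho_spanning_tree_def subgraph_def compatible_def)
    then show "T \<in> range ?mk" by (rule range_eqI)
  qed
qed simp

end

theory Submission
  imports Defs
begin

text \<open>
  Write \<open>u\<^sub>b = \<rho> b \<cdot> d\<^sub>0(b) - d\<^sub>1(b)\<close> for the boundary of the edge \<open>b\<close>. The operator is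
  \<open>\<Sum>b. (1 / r b) u\<^sub>b u\<^sub>b\<^sup>*\<close>, so the Cauchy-Binet formula (\<open>Cauchy_Binet\<close>) writes its determinant as a sum
  over the sets \<open>S\<close> of arcs that have as many elements as there are vertices. The term of \<open>S\<close> is
  \<open>\<Prod>b\<in>S. 1 / r b\<close> times the squared modulus of the determinant \<open>D\<close> with the rows \<open>u\<^sub>b\<close> for \<open>b \<in> S\<close>. As
  \<open>H0 G \<rho>\<close> is trivial, the spanning subgraph with arc set \<open>S\<close> is a twisted spanning tree iff its
  boundary map is bijective, that is, iff \<open>D\<close> is nonzero (\<open>spanning_tree_det_nonzero\<close>,
  \<open>spanning_tree_if_det_nonzero\<close>).

  It remains to see that the squared modulus of \<open>D\<close> is \<open>rho_hat T \<rho>\<close> for a tree \<open>T\<close>. A nonzero term in the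
  Leibniz expansion of \<open>D\<close> assigns to every vertex an arc at this vertex, and every arc is used once
  (\<open>ex_arc_assignment\<close>). Walking from each vertex along its arc makes \<open>T\<close> the graph of a self-map
  \<open>succ\<close> of the vertices. Up to factors of modulus one, the rows of \<open>D\<close> become
  \<open>e\<^sub>v - \<tau>\<^sub>v e\<^bsub>succ v\<^esub>\<close>, where \<open>\<tau>\<^sub>v\<close> is a parallel transport along the arc. Row operations
  along the orbits show that such a determinant is the product, over the cycles of the self-map, of one minus
  the product of the \<open>\<tau>\<^sub>v\<close> on the cycle (\<open>det_functional_matrix\<close>).

  Finally the cycles are the circuits of \<open>T\<close>. Orbits of linked vertices meet, so each component contains
  exactly one cycle. Any circuit has as many vertices as arcs, and therefore each of its vertices is assigned an arc of
  the circuit; this forces the circuit to run along \<open>succ\<close>, or against it all the way around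
  (\<open>circuit_is_orbit\<close>). So every factor of the determinant is \<open>1 - h\<close> or \<open>1 - cnj h\<close> with \<open>h\<close> the
  holonomy of the circuit chosen in the component (\<open>rho_hat_eq_det\<close>).
\<close>

section \<open>The Cauchy-Binet formula\<close>

lemma det_rows_sum:
  fixes a :: "'n::finite \<Rightarrow> 'e \<Rightarrow> 'a::comm_ring_1^'n"
  assumes "finite E"
  shows "det (\<chi> i. \<Sum>b\<in>E. a i b) = (\<Sum>f\<in>UNIV \<rightarrow>\<^sub>E E. det (\<chi> i. a i (f i)))"
proof -
  have "det (\<chi> i. \<Sum>b\<in>E. a i b) =
      (\<Sum>p | p permutes (UNIV :: 'n set). of_int (sign p) * (\<Prod>i\<in>UNIV. \<Sum>b\<in>E. a i b $ p i))"
    by (simp add: det_def)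
  also have "\<dots> = (\<Sum>p | p permutes (UNIV :: 'n set). \<Sum>f\<in>UNIV \<rightarrow>\<^sub>E E.
      of_int (sign p) * (\<Prod>i\<in>UNIV. a i (f i) $ p i))"
    using assms by (simp add: prod_sum_PiE sum_distrib_left)
  also have "\<dots> = (\<Sum>f\<in>UNIV \<rightarrow>\<^sub>E E. det (\<chi> i. a i (f i)))"
    by (subst sum.swap) (simp add: det_def)
  finally show ?thesis .
qed

text \<open>
  The maximal minor of a family of row vectors with row set \<open>S\<close>. The rows are matched with the index
  type by an arbitrary bijection, so it is determined up to sign only; the sign cancels in a product of two minors for the same \<open>S\<close>, see \<open>minor_mult_minor\<close>.
\<close>

definition minor :: "('e \<Rightarrow> 'a::comm_ring_1^'n) \<Rightarrow> 'e set \<Rightarrow> 'a" where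
  "minor x S = det (\<chi> i. x ((SOME g. bij_betw g (UNIV :: 'n set) S) i))"

lemma bij_betw_permutes:
  assumes g: "bij_betw g (UNIV :: 'n::finite set) S"
  shows "bij_betw (\<lambda>p. g \<circ> p) {p. p permutes UNIV} {f. bij_betw f UNIV S}"
proof (rule bij_betw_byWitness[where f' = "\<lambda>f. inv_into UNIV g \<circ> f"])
  have inj: "inj g" and im: "range g = S" using g by (auto simp: bij_betw_def)
  show "\<forall>p\<in>{p. p permutes UNIV}. inv_into UNIV g \<circ> (g \<circ> p) = p"
    using inj by (auto simp: fun_eq_iff)
  show "\<forall>f\<in>{f. bij_betw f UNIV S}. g \<circ> (inv_into UNIV g \<circ> f) = f"
  proof clarify
    fix f assume "bij_betw f UNIV S"
    then have "f i \<in> range g" for i using im by (auto simp: bij_betw_def)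
    then show "g \<circ> (inv_into UNIV g \<circ> f) = f" by (simp add: fun_eq_iff f_inv_into_f)
  qed
  show "(\<lambda>p. g \<circ> p) ` {p. p permutes UNIV} \<subseteq> {f. bij_betw f UNIV S}"
    using g by (auto intro: bij_betw_trans permutes_imp_bij)
  show "(\<lambda>f. inv_into UNIV g \<circ> f) ` {f. bij_betw f UNIV S} \<subseteq> {p. p permutes UNIV}"
    using bij_betw_trans[OF _ bij_betw_inv_into[OF g]] by (auto intro!: bij_imp_permutes)
qed

lemma minor_mult_minor:
  fixes x y :: "'e \<Rightarrow> 'a::comm_ring_1^'n"
  assumes g: "bij_betw g (UNIV :: 'n set) S"
  shows "minor x S * minor y S = det (\<chi> i. x (g i)) * det (\<chi> i. y (g i))"
proof -
  define h where "h = (SOME g. bij_betw g (UNIV :: 'n set) S)"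
  have "bij_betw h UNIV S" 
    unfolding h_def by (rule someI[of "\<lambda>g. bij_betw g UNIV S", OF g])
  then have "h \<in> (\<lambda>p. g \<circ> p) ` {p. p permutes UNIV}"
    using bij_betw_permutes[OF g] by (simp add: bij_betw_def)
  then obtain p where p: "p permutes UNIV" "h = g \<circ> p" by (elim imageE) simp
  have minor: "minor z S = of_int (sign p) * det (\<chi> i. z (g i))" for z :: "'e \<Rightarrow> 'a^'n"
    using det_permute_rows[OF p(1), of "\<chi> i. z (g i)"] p(2) by (simp add: minor_def h_def)
  have sq: "of_int (sign p) * of_int (sign p) = (1::'a)"
    by (simp flip: of_int_mult)
  have "of_int (sign p) * u * (of_int (sign p) * v) =
      of_int (sign p) * of_int (sign p) * (u * v)" for u v :: 'a
    by (simp only: ac_simps)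
  then show ?thesis by (simp add: minor sq)
qed

text \<open>
  The bijections onto \<open>S\<close> are the permutations of a fixed one. Permuting the rows of the second
  determinant produces the sign with which the product of entries of \<open>x\<close> enters the Leibniz expansion of
  the first.
\<close>

lemma sum_bij_det:
  fixes x y :: "'e \<Rightarrow> 'a::comm_ring_1^'n"
  assumes g: "bij_betw g (UNIV :: 'n set) S"
  shows "(\<Sum>f | bij_betw f UNIV S. (\<Prod>i\<in>UNIV. x (f i) $ i) * det (\<chi> i. y (f i))) =
    minor x S * minor y S"
proof -
  have "(\<Sum>f | bij_betw f UNIV S. (\<Prod>i\<in>UNIV. x (f i) $ i) * det (\<chi> i. y (f i))) =
      (\<Sum>p | p permutes (UNIV :: 'n set). (\<Prod>i\<in>UNIV. x (g (p i)) $ i) * det (\<chi> i. y (g (p i))))"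
    by (subst sum.reindex_bij_betw[OF bij_betw_permutes[OF g], symmetric]) simp
  also have "\<dots> = (\<Sum>p | p permutes (UNIV :: 'n set).
      of_int (sign p) * (\<Prod>i\<in>UNIV. x (g (p i)) $ i)) * det (\<chi> i. y (g i))"
    unfolding sum_distrib_right
    using det_permute_rows[of _ "\<chi> i. y (g i)"] by (intro sum.cong) (auto simp: algebra_simps)
  also have "(\<Sum>p | p permutes (UNIV :: 'n set). of_int (sign p) * (\<Prod>i\<in>UNIV. x (g (p i)) $ i)) =
      det (transpose (\<chi> i. x (g i)))"
    by (simp add: det_def transpose_def)
  finally show ?thesis by (simp add: minor_mult_minor[OF g])
qed

text \<open>
  Expanding the determinant multilinearly in its rows gives one term for every function from rows to
  \<open>E\<close>. For a function that is not injective two rows are multiples of the same vector, so only the bijections onto the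
  subsets of full size survive.
\<close>

theorem Cauchy_Binet:
  fixes x y :: "'e \<Rightarrow> 'a::comm_ring_1^'n"
  assumes "finite E"
  shows "det (\<chi> i. \<Sum>b\<in>E. x b $ i *s y b) =
    (\<Sum>S | S \<subseteq> E \<and> card S = CARD('n). minor x S * minor y S)"
proof -
  let ?t = "\<lambda>f. (\<Prod>i\<in>UNIV. x (f i) $ i) * det (\<chi> i. y (f i))"
  let ?I = "\<lambda>S. {f. bij_betw f (UNIV :: 'n set) S}"
  let ?SS = "{S. S \<subseteq> E \<and> card S = CARD('n)}"
  have "det (\<chi> i. \<Sum>b\<in>E. x b $ i *s y b) = (\<Sum>f\<in>UNIV \<rightarrow>\<^sub>E E. ?t f)"
    using assms by (simp add: det_rows_sum det_rows_mul)
  also have "\<dots> = (\<Sum>f\<in>(\<Union>S\<in>?SS. ?I S). ?t f)"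
  proof (rule sum.mono_neutral_right)
    show "finite ((UNIV :: 'n set) \<rightarrow>\<^sub>E E)" using assms by (simp add: finite_PiE)
    show "(\<Union>S\<in>?SS. ?I S) \<subseteq> UNIV \<rightarrow>\<^sub>E E" by (auto simp: bij_betw_def)
    show "\<forall>f\<in>(UNIV \<rightarrow>\<^sub>E E) - (\<Union>S\<in>?SS. ?I S). ?t f = 0"
    proof
      fix f :: "'n \<Rightarrow> 'e" assume f: "f \<in> (UNIV \<rightarrow>\<^sub>E E) - (\<Union>S\<in>?SS. ?I S)"
      have "\<not> inj f"
      proof
        assume "inj f"
        then have "range f \<in> ?SS" "f \<in> ?I (range f)"
          using f by (auto simp: card_image bij_betw_def)
        then show False using f by blast
      qed
      then obtain i j where "i \<noteq> j" "f i = f j" by (auto simp: inj_def)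
      then have "det (\<chi> i. y (f i)) = 0"
        by (intro det_identical_rows[of i j]) (auto simp: row_def)
      then show "?t f = 0" by simp
    qed
  qed
  also have "\<dots> = (\<Sum>S\<in>?SS. sum ?t (?I S))"
  proof (rule sum.UNION_disjoint)
    show "finite ?SS" using assms by simp
    show "\<forall>S\<in>?SS. finite (?I S)"
    proof
      fix S assume "S \<in> ?SS"
      then have "finite S" using assms by (auto intro: finite_subset)
      then show "finite (?I S)"
        by (intro finite_subset[OF _ finite_PiE[of UNIV "\<lambda>_. S"]]) (auto simp: bij_betw_def)
    qed
    show "\<forall>S\<in>?SS. \<forall>S'\<in>?SS. S \<noteq> S' \<longrightarrow> ?I S \<inter> ?I S' = {}" by (auto simp: bij_betw_def)
  qed
  also have "\<dots> = (\<Sum>S\<in>?SS. minor x S * minor y S)"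
  proof (rule sum.cong)
    fix S assume S: "S \<in> ?SS"
    then have "finite S" using assms by (auto intro: finite_subset)
    then obtain g where "bij_betw g (UNIV :: 'n set) S"
      using S finite_same_card_bij[of "UNIV :: 'n set" S] by auto
    then show "sum ?t (?I S) = minor x S * minor y S" by (rule sum_bij_det)
  qed simp
  finally show ?thesis .
qed

section \<open>Determinants of functional graphs\<close>

text \<open>
  This is the identity minus a weighted adjacency matrix of the functional graph of \<open>\<phi>\<close>. The pairs
  \<open>(v, \<phi> v)\<close> are the arcs of that graph and \<open>\<tau> v\<close> is the weight of the arc that leaves \<open>v\<close>.
\<close>

definition functional_matrix :: "('n \<Rightarrow> 'n) \<Rightarrow> ('n \<Rightarrow> 'a) \<Rightarrow> 'a::field^'n^'n" where
  "functional_matrix \<phi> \<tau> = (\<chi> v. axis v 1 - \<tau> v *s axis (\<phi> v) 1)"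

text \<open>
  The rows along the orbit of \<open>v\<close>, scaled by the products of the preceding weights, telescope. Adding the
  later ones to row \<open>v\<close> therefore replaces the arc from \<open>v\<close> to \<open>\<phi> v\<close> by one arc from \<open>v\<close> to
  \<open>(\<phi> ^^ m) v\<close>. The orbit must not come back to \<open>v\<close> early, because row \<open>v\<close> may not be added to itself.
\<close>

lemma det_functional_matrix_follow:
  fixes \<phi> :: "'n::finite \<Rightarrow> 'n" and \<tau> :: "'n \<Rightarrow> 'a::field"
  assumes "m > 0" and no_return: "\<And>i. 0 < i \<Longrightarrow> i < m \<Longrightarrow> (\<phi> ^^ i) v \<noteq> v"
  shows "det (functional_matrix \<phi> \<tau>) =
    det (\<chi> w. if w = v then axis v 1 - (\<Prod>i<m. \<tau> ((\<phi> ^^ i) v)) *s axis ((\<phi> ^^ m) v) 1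
      else functional_matrix \<phi> \<tau> $ w)"
proof -
  let ?A = "functional_matrix \<phi> \<tau>"
  define c where "c i = (\<Prod>j<i. \<tau> ((\<phi> ^^ j) v))" for i
  define x where "x = (\<Sum>i\<in>{1..<m}. c i *s row ((\<phi> ^^ i) v) ?A)"
  have "x \<in> vec.span {row w ?A |w. w \<noteq> v}"
    unfolding x_def
    by (intro vec.span_sum vec.span_scale vec.span_base) (use no_return in auto)
  then have "det ?A = det (\<chi> w. if w = v then row v ?A + x else row w ?A)"
    by (rule det_row_span[symmetric])
  moreover have "row v ?A + x = axis v 1 - c m *s axis ((\<phi> ^^ m) v) 1"
  proof -
    have "row v ?A + x = (\<Sum>i<m. c i *s row ((\<phi> ^^ i) v) ?A)"
      using \<open>m > 0\<close> by (simp add: x_def c_def lessThan_atLeast0 sum.atLeast_Suc_lessThan)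
    also have "\<dots> = (\<Sum>i<m. c i *s axis ((\<phi> ^^ i) v) 1 - c (Suc i) *s axis ((\<phi> ^^ Suc i) v) 1)"
      by (simp add: row_def functional_matrix_def c_def vec_eq_iff algebra_simps)
    also have "\<dots> = c 0 *s axis ((\<phi> ^^ 0) v) 1 - c m *s axis ((\<phi> ^^ m) v) 1"
      by (rule sum_lessThan_telescope')
    finally show ?thesis by (simp add: c_def)
  qed
  ultimately show ?thesis by (simp add: c_def row_def vec_lambda_eta cong: if_cong)
qed

text \<open>
  Following a cycle once around turns its arc at \<open>v\<close> into a loop, whose row is a multiple of the unit
  vector. The factor comes out and what remains is the matrix with the cycle cut at \<open>v\<close>.
\<close>

lemma det_functional_matrix_cycle:
  fixes \<phi> :: "'n::finite \<Rightarrow> 'n" and \<tau> :: "'n \<Rightarrow> 'a::field"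
  assumes "m > 0" "(\<phi> ^^ m) v = v" "\<And>i. 0 < i \<Longrightarrow> i < m \<Longrightarrow> (\<phi> ^^ i) v \<noteq> v"
  shows "det (functional_matrix \<phi> \<tau>) =
    (1 - (\<Prod>i<m. \<tau> ((\<phi> ^^ i) v))) * det (functional_matrix \<phi> (\<tau>(v := 0)))"
proof -
  let ?c = "1 - (\<Prod>i<m. \<tau> ((\<phi> ^^ i) v))"
  have "det (functional_matrix \<phi> \<tau>) =
      det (\<chi> w. if w = v then ?c *s axis w 1 else functional_matrix \<phi> \<tau> $ w)"
    using assms(2)
    by (subst det_functional_matrix_follow[of m, OF assms(1)], use assms(3) in blast)
      (auto intro!: arg_cong[of _ _ det] simp: vec_eq_iff algebra_simps)
  also have "\<dots> = ?c * det (\<chi> w. if w = v then axis w 1 else functional_matrix \<phi> \<tau> $ w)"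
    by (rule det_row_mul)
  also have "(\<chi> w. if w = v then axis w 1 else functional_matrix \<phi> \<tau> $ w) =
      functional_matrix \<phi> (\<tau>(v := 0))"
    by (simp add: functional_matrix_def vec_eq_iff)
  finally show ?thesis .
qed

text \<open>
  If every orbit runs into an arc of weight zero, there is no cycle left to contribute: each arc
  can be followed up to an arc of weight zero and thereby deleted, until the identity matrix is left.
\<close>

lemma det_functional_matrix_acyclic:
  fixes \<phi> :: "'n::finite \<Rightarrow> 'n" and \<tau> :: "'n \<Rightarrow> 'a::field"
  assumes "\<And>v. \<exists>i. \<tau> ((\<phi> ^^ i) v) = 0"
  shows "det (functional_matrix \<phi> \<tau>) = 1"
  using assms
proof (induction "card {v. \<tau> v \<noteq> 0}" arbitrary: \<tau> rule: less_induct)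
  case less
  show ?case
  proof (cases "\<forall>v. \<tau> v = 0")
    case True
    then have "functional_matrix \<phi> \<tau> = mat 1"
      by (auto simp: functional_matrix_def mat_def vec_eq_iff axis_def)
    then show ?thesis by simp
  next
    case False
    then obtain v where v: "\<tau> v \<noteq> 0" by blast
    \<comment> \<open>Up to its first arc of weight zero the orbit cannot return to \<open>v\<close>: otherwise an earlier arc would
      already have weight zero.\<close>
    define k where "k = (LEAST i. \<tau> ((\<phi> ^^ i) v) = 0)"
    have k: "\<tau> ((\<phi> ^^ k) v) = 0"
      unfolding k_def using less.prems by (rule LeastI_ex)
    have minimal: "\<tau> ((\<phi> ^^ i) v) \<noteq> 0" if "i < k" for i
      using that not_less_Least unfolding k_def by blast
    have no_return: "(\<phi> ^^ i) v \<noteq> v" if "0 < i" "i < Suc k" for i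
    proof
      assume "(\<phi> ^^ i) v = v"
      then have "(\<phi> ^^ (k - i)) v = (\<phi> ^^ k) v"
        using that funpow_add[of "k - i" i \<phi>] by simp
      then show False using minimal[of "k - i"] k that by simp
    qed
    have "det (functional_matrix \<phi> \<tau>) = det (functional_matrix \<phi> (\<tau>(v := 0)))"
      using k by (subst det_functional_matrix_follow[of "Suc k", OF zero_less_Suc], use no_return in blast)
        (auto intro!: arg_cong[of _ _ det] simp: functional_matrix_def vec_eq_iff)
    also have "\<dots> = 1"
    proof (rule less.hyps)
      show "card {w. (\<tau>(v := 0)) w \<noteq> 0} < card {w. \<tau> w \<noteq> 0}"
        using v by (intro psubset_card_mono) auto
      show "\<exists>i. (\<tau>(v := 0)) ((\<phi> ^^ i) w) = 0" for w
        using less.prems[of w] by auto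
    qed
    finally show ?thesis .
  qed
qed

text \<open>
  The set \<open>R\<close> contains exactly one vertex of every cycle, and \<open>p\<close> gives the length of its cycle.
  Cutting the cycles at these vertices one after the other leaves the other factors unchanged, since
  no other vertex of \<open>R\<close> lies on the cycle that is cut.
\<close>

lemma det_functional_matrix:
  fixes \<phi> :: "'n::finite \<Rightarrow> 'n" and \<tau> :: "'n \<Rightarrow> 'a::field"
  assumes per: "\<And>x. x \<in> R \<Longrightarrow> 0 < p x" "\<And>x. x \<in> R \<Longrightarrow> (\<phi> ^^ p x) x = x"
    and sep: "\<And>x i. x \<in> R \<Longrightarrow> 0 < i \<Longrightarrow> i < p x \<Longrightarrow> (\<phi> ^^ i) x \<notin> R"
    and reach: "\<And>v. \<exists>i. (\<phi> ^^ i) v \<in> R"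
  shows "det (functional_matrix \<phi> \<tau>) = (\<Prod>x\<in>R. 1 - (\<Prod>i<p x. \<tau> ((\<phi> ^^ i) x)))"
proof -
  let ?c = "\<lambda>x. 1 - (\<Prod>i<p x. \<tau> ((\<phi> ^^ i) x))"
  let ?cut = "\<lambda>R'. \<lambda>v. if v \<in> R' then 0 else \<tau> v"
  \<comment> \<open>The factors belong to the original weights throughout, although cycles have been cut.\<close>
  have "det (functional_matrix \<phi> \<tau>) = prod ?c R' * det (functional_matrix \<phi> (?cut R'))"
    if "finite R'" "R' \<subseteq> R" for R'
    using that
  proof (induction R')
    case empty
    show ?case by simp
  next
    case (insert x R')
    have "(\<Prod>i<p x. ?cut R' ((\<phi> ^^ i) x)) = (\<Prod>i<p x. \<tau> ((\<phi> ^^ i) x))"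
    proof (rule prod.cong)
      fix i assume "i \<in> {..<p x}"
      then have "(\<phi> ^^ i) x \<notin> R'" using insert.prems insert.hyps sep[of x i] by (cases "i = 0") auto
      then show "?cut R' ((\<phi> ^^ i) x) = \<tau> ((\<phi> ^^ i) x)" by simp
    qed simp
    moreover have "(\<phi> ^^ i) x \<noteq> x" if "0 < i" "i < p x" for i
      using sep[of x i] insert.prems that by auto
    ultimately have "det (functional_matrix \<phi> (?cut R')) =
        ?c x * det (functional_matrix \<phi> ((?cut R')(x := 0)))"
      using det_functional_matrix_cycle[of "p x" \<phi> x "?cut R'"] per[of x] insert.prems by auto
    moreover have "(?cut R')(x := 0) = ?cut (insert x R')" by auto
    ultimately show ?case using insert by simp
  qed
  from this[of R] have "det (functional_matrix \<phi> \<tau>) =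
      prod ?c R * det (functional_matrix \<phi> (?cut R))"
    by simp
  also have "det (functional_matrix \<phi> (?cut R)) = 1"
    using reach by (intro det_functional_matrix_acyclic) meson
  finally show ?thesis by simp
qed

section \<open>Connected components\<close>

abbreviation links :: "('v, 'e) pre_digraph \<Rightarrow> ('v \<times> 'v) set" where
  "links A \<equiv> parcs (mk_symmetric A)"

lemma link_tail_head: "b \<in> arcs A \<Longrightarrow> (tail A b, head A b) \<in> links A"
  and link_head_tail: "b \<in> arcs A \<Longrightarrow> (head A b, tail A b) \<in> links A"
  by (auto simp: parcs_mk_symmetric)

lemma links_subgraph: "subgraph H A \<Longrightarrow> links H \<subseteq> links A"
  using subgraph_mk_symmetric by (auto simp: subgraph_def)

lemma rtrancl_links_sym: "(u, v) \<in> (links A)\<^sup>* \<Longrightarrow> (v, u) \<in> (links A)\<^sup>*"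
  by (rule symD[OF sym_rtrancl]) (auto simp: sym_def parcs_mk_symmetric)

lemma connected_iff_links:
  assumes "wf_digraph A"
  shows "Digraph_Component.connected A \<longleftrightarrow>
    verts A \<noteq> {} \<and> (\<forall>u\<in>verts A. \<forall>v\<in>verts A. (u, v) \<in> (links A)\<^sup>*)"
proof -
  interpret pair_wf_digraph "mk_symmetric A"
    using assms by (rule wf_digraph.wellformed_mk_symmetric)
  show ?thesis
    by (simp add: Digraph_Component.connected_def strongly_connected_def reachable_conv')
qed

text \<open>
  The component of a vertex, described by reachability instead of maximality.
\<close>

definition component_of :: "('v, 'e) pre_digraph \<Rightarrow> 'v \<Rightarrow> ('v, 'e) pre_digraph" where
  "component_of A v = \<lparr>verts = (links A)\<^sup>* `` {v},
     arcs = {b \<in> arcs A. (v, tail A b) \<in> (links A)\<^sup>*}, tail = tail A, head = head A\<rparr>"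

lemma component_of_sel [simp]:
  "verts (component_of A v) = (links A)\<^sup>* `` {v}"
  "arcs (component_of A v) = {b \<in> arcs A. (v, tail A b) \<in> (links A)\<^sup>*}"
  "tail (component_of A v) = tail A" "head (component_of A v) = head A"
  by (simp_all add: component_of_def)

lemma wf_component_of: "wf_digraph (component_of A v)"
  by unfold_locales (auto intro: link_tail_head rtrancl_into_rtrancl)

lemma subgraph_component_of:
  assumes "wf_digraph A" "v \<in> verts A"
  shows "subgraph (component_of A v) A"
proof -
  have "w \<in> verts A" if "(v, w) \<in> (links A)\<^sup>*" for w
    using that assms by induction (auto simp: parcs_mk_symmetric wf_digraph_def)
  then show ?thesis
    using assms wf_component_of by (auto simp: subgraph_def compatible_def)
qed

text \<open>
  A path that starts at \<open>v\<close> visits only vertices reachable from \<open>v\<close>, so it uses only arcs of the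
  component.
\<close>

lemma connected_component_of: "Digraph_Component.connected (component_of A v)"
proof -
  have from_v: "(v, w) \<in> (links (component_of A v))\<^sup>*" if "(v, w) \<in> (links A)\<^sup>*" for w
    using that
  proof induction
    case (step w w')
    from step.hyps(2) obtain b where b: "b \<in> arcs A"
      and "w = tail A b \<and> w' = head A b \<or> w = head A b \<and> w' = tail A b"
      by (auto simp: parcs_mk_symmetric)
    moreover from this have "(v, tail A b) \<in> (links A)\<^sup>*"
      using step.hyps by (auto intro: rtrancl_into_rtrancl)
    ultimately have "(w, w') \<in> links (component_of A v)"
      by (auto simp: parcs_mk_symmetric)
    with step.IH show ?case by (rule rtrancl_into_rtrancl)
  qed simp
  then have "(u, w) \<in> (links (component_of A v))\<^sup>*"
    if "(v, u) \<in> (links A)\<^sup>*" "(v, w) \<in> (links A)\<^sup>*" for u w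
    using that by (meson rtrancl_links_sym rtrancl_trans)
  then show ?thesis
    by (auto simp: connected_iff_links[OF wf_component_of])
qed

lemma connected_subgraph_component_of:
  assumes H: "subgraph H A" "Digraph_Component.connected H" "v \<in> verts H"
  shows "subgraph H (component_of A v)"
proof -
  have wf: "wf_digraph H" using H(1) by auto
  have eq: "tail H = tail A" "head H = head A" using H(1) by (auto simp: subgraph_def compatible_def)
  have "(v, w) \<in> (links A)\<^sup>*" if "w \<in> verts H" for w
    using H(2,3) that connected_iff_links[OF wf] rtrancl_mono[OF links_subgraph[OF H(1)]] by blast
  moreover have "tail A b \<in> verts H" if "b \<in> arcs H" for b
    using wf that by (simp add: wf_digraph_def eq)
  ultimately show ?thesis
    using H(1) wf wf_component_of by (auto simp: subgraph_def compatible_def)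
qed

text \<open>
  Every connected subgraph through \<open>v\<close> lies in \<open>component_of A v\<close>. So a maximal one is of this form, and
  conversely nothing connected can be strictly larger.
\<close>

lemma components_eq:
  assumes "wf_digraph A"
  shows "components A = component_of A ` verts A"
proof
  show "component_of A ` verts A \<subseteq> components A"
  proof (rule image_subsetI)
    fix v assume v: "v \<in> verts A"
    have "H' = component_of A v"
      if H': "subgraph (component_of A v) H'" "subgraph H' A" "Digraph_Component.connected H'" for H'
    proof -
      have "v \<in> verts H'" using H'(1) by (auto simp: subgraph_def)
      then have "subgraph H' (component_of A v)"
        by (intro connected_subgraph_component_of H')
      with H'(1) have "verts H' = verts (component_of A v)" "arcs H' = arcs (component_of A v)"
        "tail H' = tail (component_of A v)" "head H' = head (component_of A v)"
        unfolding subgraph_def compatible_def by blast+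
      then show ?thesis by (intro pre_digraph.equality) simp_all
    qed
    then have "pre_digraph.max_subgraph A Digraph_Component.connected (component_of A v)"
      by (intro pre_digraph.max_subgraphI subgraph_component_of assms v connected_component_of) metis
    then show "component_of A v \<in> components A" by (simp add: components_def)
  qed
  show "components A \<subseteq> component_of A ` verts A"
  proof
    fix H assume "H \<in> components A"
    then have H: "subgraph H A" "Digraph_Component.connected H"
      and max: "\<And>H'. subgraph H H' \<Longrightarrow> subgraph H' A \<Longrightarrow> Digraph_Component.connected H' \<Longrightarrow> H' = H"
      by (auto simp: components_def pre_digraph.max_subgraph_def)
    then obtain v where v: "v \<in> verts H"
      by (auto simp: Digraph_Component.connected_def strongly_connected_def)
    then have "v \<in> verts A" using H(1) by auto
    moreover from this have "component_of A v = H"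
      by (intro max connected_subgraph_component_of H v subgraph_component_of assms
          connected_component_of)
    ultimately show "H \<in> component_of A ` verts A" by blast
  qed
qed

lemma component_of_cong:
  assumes "(u, v) \<in> (links A)\<^sup>*"
  shows "component_of A u = component_of A v"
proof -
  have "(u, w) \<in> (links A)\<^sup>* \<longleftrightarrow> (v, w) \<in> (links A)\<^sup>*" for w
    using assms rtrancl_links_sym[OF assms] by (meson rtrancl_trans)
  then show ?thesis by (auto simp: component_of_def)
qed

section \<open>Reversing circuits\<close>

definition flip_circuit :: "('e \<times> bool) list \<Rightarrow> ('e \<times> bool) list" where
  "flip_circuit C = rev (map (apsnd Not) C)"

text \<open>
  Read as an equation of lists, the closing condition makes reversal of a circuit a computation with
  \<open>rev\<close> and \<open>rotate1\<close>.
\<close>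

lemma circuit_iff_rotate1:
  "circuit A C \<longleftrightarrow> C \<noteq> [] \<and> fst ` set C \<subseteq> arcs A \<and>
     map (edge_tgt A) C = rotate1 (map (edge_src A) C) \<and>
     distinct (map (edge_src A) C) \<and> distinct (map fst C)"
proof -
  have "(\<forall>i < length C. edge_tgt A (C ! i) = edge_src A (C ! (Suc i mod length C))) \<longleftrightarrow>
      map (edge_tgt A) C = rotate1 (map (edge_src A) C)" if "C \<noteq> []"
    using that by (subst list_eq_iff_nth_eq) (simp add: nth_rotate1)
  then show ?thesis by (cases "C = []") (simp_all add: circuit_def)
qed

lemma circuit_flip:
  assumes "circuit A C"
  shows "circuit A (flip_circuit C)"
proof -
  have src: "map (edge_src A) (flip_circuit C) = rev (map (edge_tgt A) C)"
    and tgt: "map (edge_tgt A) (flip_circuit C) = rev (map (edge_src A) C)"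
    and fst: "map fst (flip_circuit C) = rev (map fst C)"
    by (auto simp: flip_circuit_def rev_map)
  have "rev xs = rotate1 (rev (rotate1 xs))" for xs :: "'z list"
    by (cases xs) auto
  then show ?thesis
    using assms unfolding circuit_iff_rotate1 src tgt fst
    by (auto simp: flip_circuit_def)
qed

lemma holonomy_flip: "holonomy \<rho> (flip_circuit C) = inverse (holonomy \<rho> C)"
  by (induction C) (auto simp: flip_circuit_def holonomy_def split_def)

lemma norm_holonomy:
  assumes "\<And>b. b \<in> fst ` set C \<Longrightarrow> cmod (\<rho> b) = 1"
  shows "cmod (holonomy \<rho> C) = 1"
  using assms by (induction C) (auto simp: holonomy_def norm_mult norm_inverse)

section \<open>Graphs with an assignment of arcs to vertices\<close>

text \<open>
  The boundary of the single edge \<open>b\<close>, that is, a column of the boundary matrix.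
\<close>

definition edge_boundary ::
  "('v::finite, 'e) pre_digraph \<Rightarrow> ('e \<Rightarrow> complex) \<Rightarrow> 'e \<Rightarrow> complex^'v" where
  "edge_boundary A \<rho> b = \<rho> b *s axis (tail A b) 1 - axis (head A b) 1"

lemma Suc_mod_eq_iff: "i < k \<Longrightarrow> Suc i mod k = i \<longleftrightarrow> k = 1"
  by (cases "Suc i = k") auto

text \<open>
  Every vertex owns one of the arcs at it, and every arc has exactly one owner. Following from each
  vertex the arc that it owns turns the graph into the functional graph of the map \<open>succ\<close> below, which
  forgets the reference orientation of the arcs.
\<close>

locale arc_assignment =
  fixes T :: "('v::finite, 'e) pre_digraph" and g :: "'v \<Rightarrow> 'e"
  assumes verts_UNIV: "verts T = UNIV"
    and bij: "bij_betw g UNIV (arcs T)"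
    and incident: "tail T (g v) = v \<or> head T (g v) = v"
begin

definition succ :: "'v \<Rightarrow> 'v" where
  "succ v = (if tail T (g v) = v then head T (g v) else tail T (g v))"

definition out :: "'v \<Rightarrow> 'e \<times> bool" where
  "out v = (g v, tail T (g v) = v)"

text \<open>
  The inverse of the holonomy along \<open>out v\<close>. With it, \<open>edge_boundary T \<rho> (g v)\<close> is,
  up to a factor of modulus one, row \<open>v\<close> of \<open>functional_matrix succ (transport \<rho>)\<close>.
\<close>

definition transport :: "('e \<Rightarrow> complex) \<Rightarrow> 'v \<Rightarrow> complex" where
  "transport \<rho> v = (if tail T (g v) = v then inverse (\<rho> (g v)) else \<rho> (g v))"

lemma wf: "wf_digraph T"
  by unfold_locales (simp_all add: verts_UNIV)

lemma inj_g: "g u = g v \<longleftrightarrow> u = v"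
  using bij by (auto simp: bij_betw_def inj_eq)

lemma g_in_arcs: "g v \<in> arcs T"
  using bij by (auto simp: bij_betw_def)

lemma fst_out [simp]: "fst (out v) = g v"
  by (simp add: out_def)

lemma edge_src_out [simp]: "edge_src T (out v) = v"
  using incident[of v] by (auto simp: out_def)

lemma edge_tgt_out [simp]: "edge_tgt T (out v) = succ v"
  by (simp add: out_def succ_def)

lemma edge_boundary_factor:
  assumes "\<rho> (g v) \<noteq> 0"
  shows "edge_boundary T \<rho> (g v) =
    (if tail T (g v) = v then \<rho> (g v) else - 1) *s (axis v 1 - transport \<rho> v *s axis (succ v) 1)"
  using assms incident[of v]
  by (auto simp: edge_boundary_def transport_def succ_def vec_eq_iff algebra_simps)

lemma det_edge_boundary:
  assumes "\<And>b. b \<in> arcs T \<Longrightarrow> cmod (\<rho> b) = 1"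
  obtains s where "cmod s = 1"
    "det (\<chi> v. edge_boundary T \<rho> (g v)) = s * det (functional_matrix succ (transport \<rho>))"
proof
  let ?s = "\<lambda>v. if tail T (g v) = v then \<rho> (g v) else - 1"
  have "cmod (?s v) = 1" for v using assms[OF g_in_arcs[of v]] by simp
  then show "cmod (prod ?s UNIV) = 1" by (simp add: prod_norm[symmetric])
  have "edge_boundary T \<rho> (g v) = ?s v *s (axis v 1 - transport \<rho> v *s axis (succ v) 1)" for v
    using assms[OF g_in_arcs[of v]] by (intro edge_boundary_factor) auto
  then show "det (\<chi> v. edge_boundary T \<rho> (g v)) =
      prod ?s UNIV * det (functional_matrix succ (transport \<rho>))"
    by (simp only: functional_matrix_def det_rows_mul)
qed

lemma arc_ends: 
  assumes "b \<in> arcs T"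
  obtains v where "b = g v" "tail T b = v \<and> head T b = succ v \<or> head T b = v \<and> tail T b = succ v"
proof -
  obtain v where v: "b = g v" using assms bij by (auto simp: bij_betw_def)
  moreover have "tail T b = v \<and> head T b = succ v \<or> head T b = v \<and> tail T b = succ v"
    using incident[of v] by (auto simp: succ_def v)
  ultimately show thesis by (rule that)
qed

lemma succ_link: "(v, succ v) \<in> links T"
  using incident[of v] link_tail_head[OF g_in_arcs[of v]] link_head_tail[OF g_in_arcs[of v]]
  by (auto simp: succ_def)

lemma orbit_linked: "(v, (succ ^^ i) v) \<in> (links T)\<^sup>*"
  by (induction i) (auto intro: succ_link rtrancl_into_rtrancl)

text \<open>
  Meeting of orbits is transitive, and the two ends of an arc have meeting orbits because the arc is
  owned by one of them and leads to the other.
\<close>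

lemma linked_orbits_meet:
  assumes "(v, w) \<in> (links T)\<^sup>*"
  shows "\<exists>i j. (succ ^^ i) v = (succ ^^ j) w"
  using assms
proof induction
  case base
  show ?case by blast
next
  case (step w w')
  then obtain i j where ij: "(succ ^^ i) v = (succ ^^ j) w" by blast
  from step.hyps(2) obtain b where b: "b \<in> arcs T"
    "w = tail T b \<and> w' = head T b \<or> w = head T b \<and> w' = tail T b"
    by (auto simp: parcs_mk_symmetric)
  then have "w' = succ w \<or> w = succ w'" by (metis arc_ends)
  then show ?case
  proof
    assume "w' = succ w"
    then have "(succ ^^ Suc i) v = (succ ^^ j) w'" by (simp add: ij funpow_swap1)
    then show ?thesis by blast
  next
    assume "w = succ w'"
    then have "(succ ^^ i) v = (succ ^^ Suc j) w'" by (simp add: ij funpow_swap1)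
    then show ?thesis by blast
  qed
qed

text \<open>
  The orbits of \<open>v\<close> and \<open>x\<close> meet, and the meeting point lies on the cycle through \<open>x\<close>. For a
  periodic vertex \<open>v\<close> this says that the component contains only one cycle of \<open>succ\<close>.
\<close>

lemma periodic_reached:
  assumes "0 < p" "(succ ^^ p) x = x" "(v, x) \<in> (links T)\<^sup>*"
  shows "\<exists>i. (succ ^^ i) v = x"
proof -
  obtain i j where ij: "(succ ^^ i) v = (succ ^^ j) x"
    using linked_orbits_meet assms(3) by blast
  have cyc: "(succ ^^ (n * p)) x = x" for n
    by (induction n) (simp_all add: funpow_add assms(2))
  \<comment> \<open>The orbit of \<open>v\<close> enters the cycle \<open>j\<close> steps after \<open>x\<close>; continue to the end of the \<open>j\<close>-th turn.\<close>
  have "(succ ^^ (j * p - j)) ((succ ^^ i) v) = (succ ^^ (j * p - j + j)) x"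
    by (simp add: ij funpow_add)
  also have "j * p - j + j = j * p" using assms(1) by (cases p) auto
  finally have "(succ ^^ (j * p - j + i)) v = x" by (simp add: cyc funpow_add)
  then show ?thesis by blast
qed

text \<open>
  There are finitely many vertices, so the orbit of \<open>v\<close> becomes periodic. One minimal period is a
  circuit: its arcs are distinct because they have distinct owners.
\<close>

lemma component_circuit_ex: "\<exists>C. circuit (component_of T v) C"
proof -
  have "\<not> inj (\<lambda>i. (succ ^^ i) v)"
    using finite_imageD[of "\<lambda>i. (succ ^^ i) v" "UNIV :: nat set"] by auto
  then obtain i j where "i < j" "(succ ^^ i) v = (succ ^^ j) v"
    by (auto simp: inj_def) (metis linorder_neqE_nat)
  define x where "x = (succ ^^ i) v"
  have "0 < j - i \<and> (succ ^^ (j - i)) x = x"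
    using \<open>i < j\<close> \<open>(succ ^^ i) v = (succ ^^ j) v\<close> funpow_add[of "j - i" i succ]
    by (simp add: x_def)
  then have ex: "\<exists>p. 0 < p \<and> (succ ^^ p) x = x" by blast
  define p where "p = (LEAST p. 0 < p \<and> (succ ^^ p) x = x)"
  have p: "0 < p" "(succ ^^ p) x = x"
    using LeastI_ex[OF ex] by (auto simp: p_def)
  have minimal: "(succ ^^ n) x \<noteq> x" if "0 < n" "n < p" for n
    using not_less_Least that unfolding p_def by blast
  have inj: "inj_on (\<lambda>n. (succ ^^ n) x) {0..<p}"
  proof (rule linorder_inj_onI)
    fix m n assume mn: "m < n" "m \<in> {0..<p}" "n \<in> {0..<p}"
    show "(succ ^^ m) x \<noteq> (succ ^^ n) x"
    proof
      assume "(succ ^^ m) x = (succ ^^ n) x"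
      then have "(succ ^^ (p - n + m)) x = (succ ^^ (p - n + n)) x"
        by (simp add: funpow_add)
      also have "\<dots> = x" using mn p by simp
      finally have "(succ ^^ (p - n + m)) x = x" .
      moreover have "(succ ^^ (p - n + m)) x \<noteq> x" using mn by (intro minimal) auto
      ultimately show False by contradiction
    qed
  qed auto
  define C where "C = map (\<lambda>n. out ((succ ^^ n) x)) [0..<p]"
  let ?H = "component_of T v"
  have ends: "edge_src ?H = edge_src T" "edge_tgt ?H = edge_tgt T"
    by (auto simp: fun_eq_iff)
  have "circuit ?H C"
    unfolding circuit_def ends
  proof (intro conjI allI impI)
    show "C \<noteq> []" using p by (simp add: C_def)
    show "fst ` set C \<subseteq> arcs ?H"
    proof -
      have "(v, (succ ^^ n) x) \<in> (links T)\<^sup>*" for n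
        unfolding x_def by (metis orbit_linked comp_apply funpow_add)
      moreover have "(w, tail T (g w)) \<in> (links T)\<^sup>*" for w
        using incident[of w] link_head_tail[OF g_in_arcs[of w]] by auto
      ultimately have "(v, tail T (g ((succ ^^ n) x))) \<in> (links T)\<^sup>*" for n
        by (metis rtrancl_trans)
      then show ?thesis by (auto simp: C_def g_in_arcs out_def)
    qed
    show "edge_tgt T (C ! n) = edge_src T (C ! (Suc n mod length C))" if "n < length C" for n
      using that p by (cases "Suc n = p") (auto simp: C_def)
    have "map (edge_src T) C = map (\<lambda>n. (succ ^^ n) x) [0..<p]"
      "map fst C = map g (map (\<lambda>n. (succ ^^ n) x) [0..<p])"
      by (simp_all add: C_def)
    then show "distinct (map (edge_src T) C)" "distinct (map fst C)"
      using inj bij by (simp_all add: distinct_map bij_betw_def inj_on_def)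
  qed
  then show ?thesis by blast
qed

text \<open>
  The owner of an arc is one of its ends, so the arcs of a circuit are owned by vertices of the
  circuit. There are as many vertices as arcs on it. Hence conversely each of its vertices owns an arc of
  the circuit, namely the one that leaves or the one that enters it.
\<close>

lemma circuit_assigned:
  assumes C: "circuit T C" and i: "i < length C"
  shows "\<exists>j<length C. g (edge_src T (C ! i)) = fst (C ! j) \<and> (i = j \<or> i = Suc j mod length C)"
proof -
  let ?V = "set (map (edge_src T) C)" and ?E = "set (map fst C)"
  have next_src: "edge_tgt T (C ! j) = edge_src T (C ! (Suc j mod length C))" if "j < length C" for j
    using C that by (simp add: circuit_def)
  have src: "distinct (map (edge_src T) C)" and arc: "distinct (map fst C)"
    using C by (auto simp: circuit_def)
  have ends: "w = edge_src T (C ! j) \<or> w = edge_tgt T (C ! j)"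
    if "g w = fst (C ! j)" for w j
    using that incident[of w] by (cases "C ! j") auto
  have "?E \<subseteq> g ` ?V"
  proof
    fix b assume b: "b \<in> ?E"
    then obtain j where j: "j < length C" "b = fst (C ! j)" by (auto simp: in_set_conv_nth)
    moreover have "b \<in> arcs T" using C b by (auto simp: circuit_def)
    then obtain w where w: "b = g w" using bij by (auto simp: bij_betw_def)
    ultimately have "w = edge_src T (C ! j) \<or> w = edge_src T (C ! (Suc j mod length C))"
      using ends[of w j] next_src[of j] by auto
    moreover have "Suc j mod length C < length C" using j by (intro mod_less_divisor) auto
    ultimately have "w \<in> ?V" using j by auto
    then show "b \<in> g ` ?V" using w by blast
  qed
  moreover have "card (g ` ?V) \<le> card ?E"
    using card_image_le[of ?V g] distinct_card[OF src] distinct_card[OF arc] by simp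
  ultimately have "?E = g ` ?V" by (intro card_seteq) auto
  then have "g (edge_src T (C ! i)) \<in> ?E" using i by auto
  then obtain j where j: "j < length C" "g (edge_src T (C ! i)) = fst (C ! j)"
    by (auto simp: in_set_conv_nth)
  moreover have "Suc j mod length C < length C" using j by (intro mod_less_divisor) auto
  ultimately have "i = j \<or> i = Suc j mod length C"
    using ends[OF j(2)] next_src[OF j(1)] i nth_eq_iff_index_eq[OF src] by auto
  with j show ?thesis by blast
qed

text \<open>
  Only a loop can be traversed in two ways from the same vertex, and a loop lies on no circuit of
  length other than one.
\<close>

lemma circuit_edge_eq_out:
  assumes C: "circuit T C" and i: "i < length C" and "length C \<noteq> 1"
    and "g v = fst (C ! i)"
  shows "v = edge_src T (C ! i) \<Longrightarrow> C ! i = out v"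
    and "v = edge_tgt T (C ! i) \<Longrightarrow> apsnd Not (C ! i) = out v"
proof -
  have "edge_tgt T (C ! i) = edge_src T (C ! (Suc i mod length C))"
    using C i by (simp add: circuit_def)
  moreover have "Suc i mod length C < length C" using i by (intro mod_less_divisor) auto
  ultimately have "edge_tgt T (C ! i) \<noteq> edge_src T (C ! i)"
    using C i assms(3) Suc_mod_eq_iff[OF i] nth_eq_iff_index_eq[of "map (edge_src T) C" _ i]
    by (auto simp: circuit_def)
  then show "v = edge_src T (C ! i) \<Longrightarrow> C ! i = out v"
    and "v = edge_tgt T (C ! i) \<Longrightarrow> apsnd Not (C ! i) = out v"
    using assms(4) by (cases "C ! i"; auto simp: out_def split: if_splits)+
qed

text \<open>
  If the first vertex owns the arc that leaves it, the circuit starts in the direction of \<open>succ\<close>;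
  if it owns the arc that enters it, the reversed circuit does. A loop both leaves and enters
  its vertex, and \<open>out\<close> traverses it along its reference orientation.
\<close>

lemma circuit_oriented:
  assumes C: "circuit T C"
  shows "C ! 0 = out (edge_src T (C ! 0)) \<or> flip_circuit C ! 0 = out (edge_src T (C ! 0))"
proof -
  have ne: "C \<noteq> []" using C by (simp add: circuit_def)
  then have "0 < length C" by simp
  from circuit_assigned[OF C this] obtain j where j: "j < length C"
    "g (edge_src T (C ! 0)) = fst (C ! j)" "j = 0 \<or> Suc j mod length C = 0" by metis
  have flip: "flip_circuit C ! 0 = apsnd Not (C ! (length C - 1))"
    using ne by (simp add: flip_circuit_def rev_nth)
  show ?thesis
  proof (cases "length C = 1")
    case True
    then obtain b s where bs: "C = [(b, s)]" by (auto simp: length_Suc_conv)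
    then have "tail T b = head T b" using C by (auto simp: circuit_def split: if_splits)
    then show ?thesis using j bs by (auto simp: out_def flip_circuit_def)
  next
    case False
    show ?thesis
    proof (cases "j = 0")
      case True
      then show ?thesis using circuit_edge_eq_out(1)[OF C j(1) False j(2)] by simp
    next
      case j0: False
      then have "Suc j = length C" using j by (metis Suc_lessI mod_less nat.simps(3))
      then have "length C - 1 = j" by simp
      moreover have "edge_src T (C ! 0) = edge_tgt T (C ! j)"
        using C j j0 by (auto simp: circuit_def)
      ultimately show ?thesis
        using circuit_edge_eq_out(2)[OF C j(1) False j(2)] flip by simp
    qed
  qed
qed

text \<open>
  Once a vertex of the circuit owns the arc that leaves it, the next vertex cannot own this same arc
  and must own the following one.
\<close>

lemma circuit_out:
  assumes C: "circuit T C" and start: "C ! 0 = out (edge_src T (C ! 0))" and i: "i < length C"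
  shows "C ! i = out ((succ ^^ i) (edge_src T (C ! 0)))"
  using i
proof (induction i)
  case 0
  then show ?case using start by simp
next
  case (Suc i)
  let ?x = "edge_src T (C ! 0)"
  have IH: "C ! i = out ((succ ^^ i) ?x)" using Suc by simp
  have src: "edge_src T (C ! Suc i) = (succ ^^ Suc i) ?x"
    using C Suc.prems IH by (auto simp: circuit_def dest!: spec[of _ i])
  from circuit_assigned[OF C Suc.prems] obtain j where j: "j < length C"
    "g (edge_src T (C ! Suc i)) = fst (C ! j)" "Suc i = j \<or> Suc i = Suc j mod length C" by blast
  have "j = Suc i"
  proof (rule ccontr)
    assume "j \<noteq> Suc i"
    then have "j = i"
      using j Suc.prems by (cases "Suc j = length C") auto
    then have "edge_src T (C ! Suc i) = edge_src T (C ! i)"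
      using j(2) by (simp add: IH inj_g)
    then show False
      using C Suc.prems nth_eq_iff_index_eq[of "map (edge_src T) C" "Suc i" i]
      by (auto simp: circuit_def)
  qed
  then show ?case
    using circuit_edge_eq_out(1)[OF C Suc.prems _ _ refl] j src Suc.prems by auto
qed

lemma circuit_is_orbit_oriented:
  assumes C: "circuit T C" and start: "C ! 0 = out (edge_src T (C ! 0))"
  defines "x \<equiv> edge_src T (C ! 0)" and "k \<equiv> length C"
  shows "(succ ^^ k) x = x" and "\<And>i. 0 < i \<Longrightarrow> i < k \<Longrightarrow> (succ ^^ i) x \<noteq> x"
    and "(\<Prod>i<k. transport \<rho> ((succ ^^ i) x)) = inverse (holonomy \<rho> C)"
proof -
  have out: "C ! i = out ((succ ^^ i) x)" if "i < k" for i
    using circuit_out[OF C start] that by (simp add: x_def k_def)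
  have "0 < k" using C by (simp add: circuit_def k_def)
  have "edge_tgt T (C ! (k - 1)) = edge_src T (C ! 0)"
    using C \<open>0 < k\<close> by (auto simp: circuit_def k_def dest!: spec[of _ "length C - 1"])
  then have "succ ((succ ^^ (k - 1)) x) = x"
    using out[of "k - 1"] \<open>0 < k\<close> by (simp add: x_def)
  then show "(succ ^^ k) x = x" using \<open>0 < k\<close> by (cases k) simp_all
  show "(succ ^^ i) x \<noteq> x" if "0 < i" "i < k" for i
    using C that out[of i] nth_eq_iff_index_eq[of "map (edge_src T) C" i 0]
    by (auto simp: circuit_def k_def x_def)
  have C_eq: "C = map (\<lambda>i. out ((succ ^^ i) x)) [0..<k]"
    using out by (intro nth_equalityI) (simp_all add: k_def)
  have "holonomy \<rho> C = (\<Prod>i<k. inverse (transport \<rho> ((succ ^^ i) x)))"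
    unfolding holonomy_def C_eq
    by (simp add: comp_def out_def transport_def prod.list_conv_set_nth atLeast0LessThan
        if_distrib[of inverse] cong: if_cong)
  then show "(\<Prod>i<k. transport \<rho> ((succ ^^ i) x)) = inverse (holonomy \<rho> C)"
    by (simp add: prod_inversef[symmetric])
qed

text \<open>
  Reversing the circuit if necessary, it runs along \<open>succ\<close>. So the circuit chosen in \<open>rho_hat\<close> has the
  holonomy of the cycle of \<open>succ\<close> in its component, up to inversion.
\<close>

lemma circuit_is_orbit:
  assumes C: "circuit T C"
  defines "x \<equiv> edge_src T (C ! 0)" and "k \<equiv> length C"
  shows "(succ ^^ k) x = x" and "\<And>i. 0 < i \<Longrightarrow> i < k \<Longrightarrow> (succ ^^ i) x \<noteq> x"
    and "(\<Prod>i<k. transport \<rho> ((succ ^^ i) x)) \<in> {holonomy \<rho> C, inverse (holonomy \<rho> C)}"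
proof -
  have "0 < length C" using C by (simp add: circuit_def)
  have flip_src: "edge_src T (flip_circuit C ! 0) = x" and flip_len: "length (flip_circuit C) = k"
  proof -
    have "edge_src T (flip_circuit C ! 0) = edge_tgt T (C ! (length C - 1))"
      using \<open>0 < length C\<close> by (cases "C ! (length C - 1)") (simp add: flip_circuit_def rev_nth)
    also have "\<dots> = x"
      using C \<open>0 < length C\<close> by (auto simp: circuit_def x_def dest!: spec[of _ "length C - 1"])
    finally show "edge_src T (flip_circuit C ! 0) = x" .
    show "length (flip_circuit C) = k" by (simp add: flip_circuit_def k_def)
  qed
  from circuit_oriented[OF C] show "(succ ^^ k) x = x"
    "\<And>i. 0 < i \<Longrightarrow> i < k \<Longrightarrow> (succ ^^ i) x \<noteq> x"
    "(\<Prod>i<k. transport \<rho> ((succ ^^ i) x)) \<in> {holonomy \<rho> C, inverse (holonomy \<rho> C)}"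
  proof (atomize (full), elim disjE, goal_cases)
    case 1
    then show ?case
      using circuit_is_orbit_oriented[OF C] by (simp add: x_def k_def)
  next
    case 2
    then have "flip_circuit C ! 0 = out (edge_src T (flip_circuit C ! 0))"
      using flip_src by (simp add: x_def)
    from circuit_is_orbit_oriented[OF circuit_flip[OF C] this] show ?case
      by (simp add: flip_src flip_len holonomy_flip)
  qed
qed

text \<open>
  The determinant of the functional matrix is a product over the cycles of \<open>succ\<close>, which correspond
  to the components of \<open>T\<close>. Its cycles carry the holonomies of the chosen circuits or their inverses.
  As \<open>\<rho>\<close> is unitary, the inverse is the conjugate, and \<open>(1 - h) * cnj (1 - h)\<close> does not distinguish
  \<open>h\<close> from \<open>cnj h\<close>.
\<close>

theorem rho_hat_eq_det:
  assumes unitary: "\<And>b. b \<in> arcs T \<Longrightarrow> cmod (\<rho> b) = 1"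
  shows "rho_hat T \<rho> =
    det (\<chi> v. edge_boundary T \<rho> (g v)) * cnj (det (\<chi> v. edge_boundary T \<rho> (g v)))"
proof -
  define circ where "circ H = (SOME C. circuit H C)" for H :: "('v, 'e) pre_digraph"
  define base where "base H = edge_src T (circ H ! 0)" for H
  define h where "h H = holonomy \<rho> (circ H)" for H
  define P where "P x k = (\<Prod>i<k. transport \<rho> ((succ ^^ i) x))" for x k
  have comp: "\<exists>v. H = component_of T v" if "H \<in> components T" for H
    using that by (auto simp: components_eq[OF wf])
  have circ_H: "circuit H (circ H)" if "H \<in> components T" for H
    unfolding circ_def using comp[OF that] component_circuit_ex by (metis someI_ex)
  have circ_T: "circuit T (circ H)" if H: "H \<in> components T" for H
  proof -
    obtain v where v: "H = component_of T v" using comp[OF H] by blast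
    have "edge_src H = edge_src T" "edge_tgt H = edge_tgt T"
      unfolding v by (auto simp: fun_eq_iff)
    moreover have "arcs H \<subseteq> arcs T" unfolding v by auto
    ultimately show ?thesis using circ_H[OF H] by (auto simp: circuit_def)
  qed
  have component_base: "component_of T (base H) = H" if H: "H \<in> components T" for H
  proof -
    obtain v where v: "H = component_of T v" using comp[OF H] by blast
    have "fst (circ H ! 0) \<in> arcs H" using circ_H[OF H] by (auto simp: circuit_def)
    moreover have "wf_digraph H" "tail H = tail T" "head H = head T"
      unfolding v by (simp_all add: wf_component_of)
    ultimately have "base H \<in> verts H"
      by (cases "circ H ! 0") (auto simp: base_def wf_digraph_def)
    moreover have "verts H = (links T)\<^sup>* `` {v}" unfolding v by simp
    ultimately have "(v, base H) \<in> (links T)\<^sup>*" by blast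
    then show ?thesis using component_of_cong v by metis
  qed
  have inj: "inj_on base (components T)"
    by (rule inj_on_inverseI[of _ "component_of T"]) (rule component_base)
  \<comment> \<open>The base points of the chosen circuits represent the cycles of \<open>succ\<close>.\<close>
  define period where "period x = length (circ (component_of T x))" for x
  have period_base: "period (base H) = length (circ H)" if "H \<in> components T" for H
    by (simp add: period_def component_base[OF that])
  have pos: "0 < length (circ H)" if "H \<in> components T" for H
    using circ_T[OF that] by (simp add: circuit_def)
  have "det (functional_matrix succ (transport \<rho>)) =
      (\<Prod>x\<in>base ` components T. 1 - P x (period x))"
    unfolding P_def
  proof (rule det_functional_matrix)
    fix x assume "x \<in> base ` components T"
    then obtain H where H: "H \<in> components T" and x: "x = base H" by blast
    note orbit = circuit_is_orbit[OF circ_T[OF H], folded base_def x]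
    have px: "period x = length (circ H)" by (simp add: x period_base[OF H])
    show "0 < period x" using pos[OF H] px by simp
    show "(succ ^^ period x) x = x" using orbit(1) px by simp
    fix i assume i: "0 < i" "i < period x"
    show "(succ ^^ i) x \<notin> base ` components T"
    proof
      assume "(succ ^^ i) x \<in> base ` components T"
      then obtain H' where H': "H' \<in> components T" "(succ ^^ i) x = base H'" by blast
      then have "H' = component_of T x"
        using component_base component_of_cong[OF orbit_linked] by metis
      then have "(succ ^^ i) x = x" using H' component_base[OF H] x by simp
      then show False using orbit(2) i px by simp
    qed
  next
    fix v
    have H: "component_of T v \<in> components T" by (simp add: components_eq[OF wf] verts_UNIV)
    let ?x = "base (component_of T v)"
    have "v \<in> verts (component_of T ?x)" by (simp add: component_base[OF H])
    then have "(v, ?x) \<in> (links T)\<^sup>*" by (simp add: rtrancl_links_sym)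
    then have "\<exists>i. (succ ^^ i) v = ?x"
      using periodic_reached[OF pos[OF H]] circuit_is_orbit(1)[OF circ_T[OF H]]
      by (simp add: base_def)
    then show "\<exists>i. (succ ^^ i) v \<in> base ` components T" using H by blast
  qed
  also have "\<dots> = (\<Prod>H\<in>components T. 1 - P (base H) (length (circ H)))"
    unfolding prod.reindex[OF inj] by (intro prod.cong) (simp_all add: period_base)
  finally have det: "det (functional_matrix succ (transport \<rho>)) =
      (\<Prod>H\<in>components T. 1 - P (base H) (length (circ H)))" .
  obtain s where s: "cmod s = 1"
    "det (\<chi> v. edge_boundary T \<rho> (g v)) = s * det (functional_matrix succ (transport \<rho>))"
    using det_edge_boundary[of \<rho>] unitary by blast
  have "s * cnj s = 1" using complex_norm_square[of s] s(1) by simp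
  then have "det (\<chi> v. edge_boundary T \<rho> (g v)) * cnj (det (\<chi> v. edge_boundary T \<rho> (g v))) =
      det (functional_matrix succ (transport \<rho>)) * cnj (det (functional_matrix succ (transport \<rho>)))"
    unfolding s(2) complex_cnj_mult by algebra
  also have "\<dots> = (\<Prod>H\<in>components T. (h H - 1) * (cnj (h H) - 1))"
    unfolding det cnj_prod prod.distrib[symmetric]
  proof (rule prod.cong)
    fix H assume H: "H \<in> components T"
    have "fst ` set (circ H) \<subseteq> arcs T" using circ_T[OF H] by (simp add: circuit_def)
    then have "cmod (h H) = 1" unfolding h_def using unitary by (intro norm_holonomy) auto
    then have "inverse (h H) = cnj (h H)"
      using complex_norm_square[of "h H"] by (intro inverse_unique) simp
    then have "P (base H) (length (circ H)) \<in> {h H, cnj (h H)}"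
      using circuit_is_orbit(3)[OF circ_T[OF H], of \<rho>] by (simp add: P_def base_def h_def)
    then show "(1 - P (base H) (length (circ H))) * cnj (1 - P (base H) (length (circ H))) =
        (h H - 1) * (cnj (h H) - 1)"
      by (auto simp: algebra_simps)
  qed simp
  also have "\<dots> = rho_hat T \<rho>" by (simp add: rho_hat_def h_def circ_def Let_def)
  finally show ?thesis by simp
qed

end

section \<open>Twisted spanning trees and nonzero minors\<close>

lemma boundary_eq: "boundary A \<rho> c = (\<Sum>b\<in>arcs A. c $ b *s edge_boundary A \<rho> b)"
  by (simp add: boundary_def edge_boundary_def)

lemma boundary_surj_if_H0_trivial:
  assumes "is_singleton (H0 A \<rho>)" "x \<in> C0 A"
  obtains c where "c \<in> C1 A" "boundary A \<rho> c = x"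
proof -
  have "0 \<in> C0 A" by (simp add: C0_def)
  then have "homologous A \<rho> `` {x} = homologous A \<rho> `` {0}"
    using assms unfolding H0_def is_singleton_def by (metis quotientI singletonD)
  then have "(x, 0) \<in> homologous A \<rho>"
    using eq_equiv_class[OF _ equiv_homologous \<open>0 \<in> C0 A\<close>] by blast
  then show thesis using that by (auto simp: homologous_def)
qed

lemma H0_trivial_if_boundary_surj:
  assumes "C0 A \<subseteq> boundary A \<rho> ` C1 A"
  shows "H0 A \<rho> = {homologous A \<rho> `` {0}}"
proof -
  have zero: "0 \<in> C0 A" by (simp add: C0_def)
  have "homologous A \<rho> `` {x} = homologous A \<rho> `` {0}" if "x \<in> C0 A" for x
  proof (rule equiv_class_eq[OF equiv_homologous])
    show "(x, 0) \<in> homologous A \<rho>" using subsetD[OF assms that] that zero by (simp add: homologous_def)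
  qed
  then have "H0 A \<rho> = (\<Union>x\<in>C0 A. {homologous A \<rho> `` {0}})"
    unfolding H0_def quotient_def by (intro SUP_cong) simp_all
  then show ?thesis using zero by blast
qed

text \<open>
  For a twisted spanning tree the boundary map is injective since \<open>H1\<close> vanishes, and surjective since
  \<open>H0\<close> of the tree is as small as that of \<open>G\<close>. So the boundaries of its edges form a basis of the
  space of all 0-chains.
\<close>

lemma spanning_tree_det_nonzero:
  fixes G T :: "('v::finite, 'e::finite) pre_digraph"
  assumes tree: "rho_spanning_tree G \<rho> T" and "verts G = UNIV"
    and "H0 G \<rho> = {homologous G \<rho> `` {0}}"
  shows "card (arcs T) = CARD('v)"
    and "bij_betw g UNIV (arcs T) \<Longrightarrow> det (\<chi> v. edge_boundary T \<rho> (g v)) \<noteq> 0"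
proof -
  let ?u = "edge_boundary T \<rho>"
  have inj: "c = 0" if "c \<in> C1 T" "boundary T \<rho> c = 0" for c
    using tree that by (auto simp: rho_spanning_tree_def H1_def)
  have "bij_betw (H0_map G \<rho>) (H0 T \<rho>) {homologous G \<rho> `` {0}}"
    using tree assms(3) by (simp add: rho_spanning_tree_def)
  then have "is_singleton (H0 T \<rho>)"
    by (metis bij_betw_same_card is_singletonI is_singleton_altdef)
  moreover have "C0 T = UNIV" using tree assms(2) by (simp add: rho_spanning_tree_def C0_def)
  ultimately have span: "vec.span (?u ` arcs T) = UNIV"
  proof -
    have "x \<in> vec.span (?u ` arcs T)" for x
    proof -
      obtain c where "boundary T \<rho> c = x"
        using boundary_surj_if_H0_trivial \<open>is_singleton (H0 T \<rho>)\<close> \<open>C0 T = UNIV\<close> by blast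
      moreover have "boundary T \<rho> c \<in> vec.span (?u ` arcs T)"
        unfolding boundary_eq by (intro vec.span_sum vec.span_scale vec.span_base imageI)
      ultimately show ?thesis by simp
    qed
    then show ?thesis by blast
  qed
  have "inj_on ?u (arcs T)"
  proof (rule inj_onI, rule ccontr)
    fix b b' assume b: "b \<in> arcs T" "b' \<in> arcs T" "?u b = ?u b'" "b \<noteq> b'"
    have "boundary T \<rho> (axis a 1) = ?u a" if "a \<in> arcs T" for a
      using that unfolding boundary_eq
      by (subst sum.remove[of _ a]) (auto simp: axis_def intro!: sum.neutral)
    then have "boundary T \<rho> (axis b 1 + (- 1) *s axis b' 1) = 0"
      using b by (simp only: boundary_add boundary_scale) simp
    then have "axis b 1 + (- 1) *s axis b' 1 = (0 :: complex^'e)"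
      using b by (intro inj) (auto simp: C1_def axis_def)
    then have "(axis b 1 + (- 1) *s axis b' 1) $ b = (0 :: complex)" by simp
    then show False using b by (simp add: axis_def)
  qed
  moreover have "vec.independent (?u ` arcs T)"
  proof
    assume "vec.dependent (?u ` arcs T)"
    then obtain k b where k: "(\<Sum>x\<in>?u ` arcs T. k x *s x) = 0" "b \<in> arcs T" "k (?u b) \<noteq> 0"
      by (subst (asm) vec.dependent_finite) auto
    define c :: "complex^'e" where "c = (\<chi> b. if b \<in> arcs T then k (?u b) else 0)"
    have "boundary T \<rho> c = 0"
      using k(1) \<open>inj_on ?u (arcs T)\<close> by (simp add: boundary_eq c_def sum.reindex)
    then have "c = 0" by (intro inj) (auto simp: c_def C1_def)
    then have "c $ b = 0" by simp
    then show False using k by (simp add: c_def)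
  qed
  ultimately have "card (arcs T) = vec.dim (?u ` arcs T)"
    by (simp add: vec.dim_eq_card_independent card_image)
  also have "\<dots> = vec.dim (UNIV :: (complex^'v) set)"
    using vec.dim_span[of "?u ` arcs T"] by (simp only: span)
  also have "\<dots> = CARD('v)" by (rule vec_dim_card)
  finally show "card (arcs T) = CARD('v)" .
  show "det (\<chi> v. ?u (g v)) \<noteq> 0" if g: "bij_betw g UNIV (arcs T)"
  proof -
    have "rows (\<chi> v. ?u (g v)) = ?u ` arcs T"
    proof -
      have "rows (\<chi> v. ?u (g v)) = range (\<lambda>v. ?u (g v))"
        by (auto simp: rows_def row_def vec_lambda_eta)
      also have "\<dots> = ?u ` range g" by (simp add: image_image)
      also have "range g = arcs T" using g by (simp add: bij_betw_def)
      finally show ?thesis .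
    qed
    then have "invertible (\<chi> v. ?u (g v))"
      unfolding invertible_left_inverse matrix_left_invertible_span_rows_gen by (simp only: span)
    then show ?thesis by (simp add: invertible_det_nz)
  qed
qed

lemma spanning_tree_if_det_nonzero:
  fixes G T :: "('v::finite, 'e::finite) pre_digraph"
  assumes sub: "subgraph T G" and verts: "verts T = UNIV" "verts G = UNIV"
    and H0: "H0 G \<rho> = {homologous G \<rho> `` {0}}"
    and g: "bij_betw g UNIV (arcs T)"
    and det: "det (\<chi> v. edge_boundary T \<rho> (g v)) \<noteq> 0"
  shows "rho_spanning_tree G \<rho> T"
proof -
  let ?u = "edge_boundary T \<rho>"
  let ?A = "\<chi> v. ?u (g v)"
  have row: "row v ?A = ?u (g v)" for v by (simp add: row_def vec_lambda_eta)
  have inv: "invertible ?A" using det by (simp add: invertible_det_nz)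
  have boundary_g: "boundary T \<rho> c = (\<Sum>v\<in>UNIV. c $ g v *s ?u (g v))" for c
    unfolding boundary_eq using sum.reindex_bij_betw[OF g, of "\<lambda>b. c $ b *s ?u b"] by simp
  have "c = 0" if c: "c \<in> C1 T" "boundary T \<rho> c = 0" for c
  proof -
    have "(\<Sum>v\<in>UNIV. k v *s row v ?A) = 0 \<longrightarrow> (\<forall>v. k v = 0)" for k
      using inv unfolding invertible_right_inverse matrix_right_invertible_independent_rows by blast
    from this[of "\<lambda>v. c $ g v"] have "c $ g v = 0" for v
      using c(2) unfolding boundary_g row by blast
    then have "c $ b = 0" for b
      using c(1) bij_betw_imp_surj_on[OF g] by (cases "b \<in> arcs T") (force simp: C1_def)+
    then show ?thesis by (simp add: vec_eq_iff)
  qed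
  moreover have "0 \<in> H1 T \<rho>" by (auto simp: H1_def C1_def boundary_def)
  ultimately have "H1 T \<rho> = {0}" by (auto simp: H1_def)
  moreover have "C0 T \<subseteq> boundary T \<rho> ` C1 T"
  proof
    fix x
    have "invertible (transpose ?A)" using det by (simp add: invertible_det_nz)
    then obtain y where "transpose ?A *v y = x"
      unfolding invertible_right_inverse matrix_right_invertible_surjective by (metis surjD)
    then have y: "(\<Sum>v\<in>UNIV. y $ v *s ?u (g v)) = x"
      by (simp add: matrix_mult_sum column_transpose row)
    define c :: "complex^'e" where "c = (\<chi> b. if b \<in> arcs T then y $ inv_into UNIV g b else 0)"
    have "c $ g v = y $ v" for v
      using g by (auto simp: c_def bij_betw_def)
    then have "boundary T \<rho> c = x" by (simp add: boundary_g y)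
    moreover have "c \<in> C1 T" by (simp add: c_def C1_def)
    ultimately show "x \<in> boundary T \<rho> ` C1 T" by blast
  qed
  then have "H0 T \<rho> = {homologous T \<rho> `` {0}}" by (rule H0_trivial_if_boundary_surj)
  then have "bij_betw (H0_map G \<rho>) (H0 T \<rho>) (H0 G \<rho>)"
    using H0_map_class[OF sub, of 0 \<rho>] by (simp add: H0 bij_betw_def C0_def)
  ultimately show ?thesis
    using sub verts by (simp add: rho_spanning_tree_def)
qed

text \<open>
  A nonzero determinant has a nonzero term in its Leibniz expansion. Its permutation selects for every
  row, that is, every arc, a vertex at which the boundary of the arc does not vanish, and such a vertex is
  an end of the arc.
\<close>

lemma ex_arc_assignment:
  fixes T :: "('v::finite, 'e) pre_digraph"
  assumes "verts T = UNIV" and g: "bij_betw g UNIV (arcs T)"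
    and det: "det (\<chi> v. edge_boundary T \<rho> (g v)) \<noteq> 0"
  obtains h where "arc_assignment T h"
proof -
  obtain p where p: "p permutes (UNIV :: 'v set)"
    and nz: "(\<Prod>v\<in>UNIV. edge_boundary T \<rho> (g v) $ p v) \<noteq> 0"
    using det unfolding det_def by (auto elim!: sum.not_neutral_contains_not_neutral)
  have "arc_assignment T (g \<circ> inv p)"
  proof
    show "verts T = UNIV" by fact
    show "bij_betw (g \<circ> inv p) UNIV (arcs T)"
      using bij_betw_trans[OF permutes_imp_bij[OF permutes_inv[OF p]] g] .
    fix v
    have "edge_boundary T \<rho> (g (inv p v)) $ p (inv p v) \<noteq> 0" using nz by simp
    then have "edge_boundary T \<rho> (g (inv p v)) $ v \<noteq> 0" using permutes_inverses(1)[OF p] by simp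
    then show "tail T ((g \<circ> inv p) v) = v \<or> head T ((g \<circ> inv p) v) = v"
      by (auto simp: edge_boundary_def axis_def split: if_splits)
  qed
  then show thesis by (rule that)
qed

section \<open>The matrix of the operator and the determinant formula\<close>

lemma det_cnj: "det (\<chi> i j. cnj (A $ i $ j)) = cnj (det A)"
  by (simp add: det_def)

text \<open>
  The weights enter one of the two factors only, so that they appear to the first power.
\<close>

lemma weighted_minors_eq:
  assumes g: "bij_betw g UNIV S"
  shows "minor (\<lambda>b. of_real (inverse (r b)) *s edge_boundary G \<rho> b) S *
      minor (\<lambda>b. \<chi> v. cnj (edge_boundary G \<rho> b $ v)) S =
    (\<Prod>b\<in>S. of_real (inverse (r b))) *
    (det (\<chi> v. edge_boundary G \<rho> (g v)) * cnj (det (\<chi> v. edge_boundary G \<rho> (g v))))"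
proof -
  have "(\<Prod>v\<in>UNIV. of_real (inverse (r (g v)))) = (\<Prod>b\<in>S. complex_of_real (inverse (r b)))"
    using prod.reindex_bij_betw[OF g, of "\<lambda>b. complex_of_real (inverse (r b))"] .
  then show ?thesis
    unfolding minor_mult_minor[OF g]
    using det_cnj[of "\<chi> v. edge_boundary G \<rho> (g v)"]
    by (simp add: det_rows_mul)
qed

lemma boundary_adj_axis:
  fixes G :: "('v::finite, 'e::finite) pre_digraph"
  assumes "wf_digraph G" "\<And>b. b \<in> arcs G \<Longrightarrow> r b > 0" "verts G = UNIV" and b: "b \<in> arcs G"
  shows "boundary_adj G \<rho> r (axis v 1) $ b =
    of_real (inverse (r b)) * cnj (edge_boundary G \<rho> b $ v)"
proof -
  let ?d = "boundary_adj G \<rho> r (axis v 1)"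
  have "axis b 1 \<in> C1 G" using b by (auto simp: C1_def axis_def)
  then have "inner0 G (boundary G \<rho> (axis b 1)) (axis v 1) = inner1 G r (axis b 1) ?d"
    by (intro inner_boundary_adj assms(1,2))
  moreover have "boundary G \<rho> (axis b 1) = edge_boundary G \<rho> b"
    using b unfolding boundary_eq
    by (subst sum.remove[of _ b]) (auto simp: axis_def intro!: sum.neutral)
  moreover have "inner0 G x (axis v 1) = x $ v" for x
    by (simp add: inner0_def assms(3) axis_def if_distrib[of cnj] if_distrib[of "\<lambda>z. _ * z"] cong: if_cong)
  moreover have "inner1 G r (axis b 1) ?d = of_real (r b) * cnj (?d $ b)"
    using b by (simp add: inner1_def axis_def if_distrib[of "\<lambda>z. z * _"] if_distrib[of "\<lambda>z. _ * z"] cong: if_cong)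
  ultimately have "cnj (edge_boundary G \<rho> b $ v) = of_real (r b) * ?d $ b"
    by (metis complex_cnj_cnj complex_cnj_complex_of_real complex_cnj_mult)
  then show ?thesis using assms(2)[OF b] by simp
qed

text \<open>
  The operator has the matrix \<open>\<Sum>b. (1 / r b) u\<^sub>b u\<^sub>b\<^sup>*\<close> with \<open>u\<^sub>b\<close> the boundary of \<open>b\<close>, to which the
  Cauchy-Binet formula applies. An arc set of the right size that does not come from a
  spanning tree has a vanishing minor, and for the others \<open>rho_hat_eq_det\<close> identifies the term.
\<close>

theorem theorem3:
  fixes G :: "('v::finite, 'e::finite) pre_digraph"
    and \<rho> :: "'e \<Rightarrow> complex"
    and r :: "'e \<Rightarrow> real"
  assumes "fin_digraph G" and "verts G = UNIV"
    and "Digraph_Component.connected G"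
    and "\<And>b. b \<in> arcs G \<Longrightarrow> cmod (\<rho> b) = 1"
    and "H0 G \<rho> = {homologous G \<rho> `` {0}}"
    and "\<And>b. b \<in> arcs G \<Longrightarrow> r b > 0"
  shows "det (matrix (\<lambda>x. boundary G \<rho> (boundary_adj G \<rho> r x))) =
    (\<Sum>T\<in>{T. rho_spanning_tree G \<rho> T}. tree_weight T \<rho> r)"
proof -
  let ?u = "edge_boundary G \<rho>"
  let ?t = "\<lambda>S. minor (\<lambda>b. of_real (inverse (r b)) *s ?u b) S * minor (\<lambda>b. \<chi> v. cnj (?u b $ v)) S"
  let ?trees = "{T. rho_spanning_tree G \<rho> T}"
  let ?SS = "{S. S \<subseteq> arcs G \<and> card S = CARD('v)}"
  have wf: "wf_digraph G" using assms(1) by (simp add: fin_digraph_def)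
  have "matrix (\<lambda>x. boundary G \<rho> (boundary_adj G \<rho> r x)) =
      (\<chi> i. \<Sum>b\<in>arcs G. (of_real (inverse (r b)) *s ?u b) $ i *s (\<chi> v. cnj (?u b $ v)))"
    using boundary_adj_axis[OF wf assms(6,2)]
    by (simp add: matrix_def boundary_eq vec_eq_iff mult.commute mult.left_commute)
  then have "det (matrix (\<lambda>x. boundary G \<rho> (boundary_adj G \<rho> r x))) =
      (\<Sum>S\<in>?SS. ?t S)"
    by (simp only: Cauchy_Binet[OF finite])
  also have "\<dots> = (\<Sum>S\<in>arcs ` ?trees. ?t S)"
  proof (rule sum.mono_neutral_right)
    show "arcs ` ?trees \<subseteq> ?SS"
      using spanning_tree_det_nonzero(1)[OF _ assms(2,5)]
      by (auto simp: rho_spanning_tree_def subgraph_def)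
    show "\<forall>S\<in>?SS - arcs ` ?trees. ?t S = 0"
    proof
      fix S assume S: "S \<in> ?SS - arcs ` ?trees"
      then obtain g where g: "bij_betw g (UNIV :: 'v set) S"
        using finite_same_card_bij[of "UNIV :: 'v set" S] by auto
      define T where "T = \<lparr>verts = UNIV, arcs = S, tail = tail G, head = head G\<rparr>"
      have "subgraph T G"
        using wf S assms(2) by (auto simp: T_def subgraph_def compatible_def wf_digraph_def)
      moreover have "T \<notin> ?trees" using S by (force simp: T_def)
      ultimately have "det (\<chi> v. edge_boundary T \<rho> (g v)) = 0"
        using spanning_tree_if_det_nonzero[OF _ _ assms(2,5), of T g] g by (auto simp: T_def)
      moreover have "edge_boundary T \<rho> = ?u" by (simp add: edge_boundary_def T_def fun_eq_iff)
      ultimately show "?t S = 0"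
        unfolding weighted_minors_eq[OF g] by simp
    qed
  qed simp
  also have "\<dots> = (\<Sum>T\<in>?trees. ?t (arcs T))"
  proof (rule sum.reindex_cong[of arcs])
    show "inj_on arcs ?trees"
      by (intro inj_onI pre_digraph.equality)
        (auto simp: rho_spanning_tree_def subgraph_def compatible_def)
  qed simp_all
  also have "\<dots> = (\<Sum>T\<in>?trees. tree_weight T \<rho> r)"
  proof (rule sum.cong)
    fix T assume T: "T \<in> ?trees"
    then have "card (arcs T) = CARD('v)" using spanning_tree_det_nonzero(1)[OF _ assms(2,5)] by blast
    then obtain g where g: "bij_betw g (UNIV :: 'v set) (arcs T)"
      using finite_same_card_bij[of "UNIV :: 'v set" "arcs T"] by auto
    have "verts T = UNIV" and sub: "arcs T \<subseteq> arcs G" "tail T = tail G" "head T = head G"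
      using T assms(2) by (auto simp: rho_spanning_tree_def subgraph_def compatible_def)
    moreover have "det (\<chi> v. edge_boundary T \<rho> (g v)) \<noteq> 0"
      using spanning_tree_det_nonzero(2)[OF _ assms(2,5) g] T by blast
    ultimately obtain h where h: "arc_assignment T h" using ex_arc_assignment g by metis
    then interpret arc_assignment T h .
    have u: "edge_boundary T \<rho> = ?u" by (simp add: edge_boundary_def fun_eq_iff sub)
    have "rho_hat T \<rho> = det (\<chi> v. ?u (h v)) * cnj (det (\<chi> v. ?u (h v)))"
      using rho_hat_eq_det[of \<rho>] assms(4) sub(1) by (auto simp: u)
    then show "?t (arcs T) = tree_weight T \<rho> r"
      unfolding weighted_minors_eq[OF bij] tree_weight_def by (simp only: mult.commute)
  qed simp
  finally show ?thesis .
qed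

end
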